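(* Let $\Omega\subset\mathbb{R}^n$ be open and let $p:\Omega\to[1,\infty)$ be measurable with $p^+=\operatorname{ess\,sup}_{\Omega}p<\infty$. Then the space $\widetilde{\mathrm{BV}}^{p(\cdot)}(\Omega)$ equipped with the norm $\|\cdot\|_{\widetilde{\mathrm{BV}}^{p(\cdot)}}$ is a Banach space.
   Context: $L^{p(\cdot)}(\Omega)$ is the variable exponent Lebesgue space of measurable $u:\Omega\to\mathbb{R}$ (identified when equal a.e.) with $\int_\Omega |u/\lambda|^{p(x)}dx<\infty$ for some $\lambda>0$, with Luxemburg norm $\|u\|_{p(\cdot)}=\inf\{\lambda>0:\int_\Omega|u/\lambda|^{p(x)}dx\le 1\}$. $\mathrm{Lip}_{\mathrm{loc}}(\Omega)$ denotes the locally Lipschitz functions on $\Omega$. For $u\in L^{p(\cdot)}(\Omega)$ define $$\varrho_{\widetilde{\mathrm{BV}}^{p(\cdot)}}(u)=\inf\Big\{\liminf_{i\to\infty}\int_\Omega|\nabla u_i(x)|^{p(x)}dx\Big\},$$ the infimum being over all sequences $(u_i)_{i=1}^\infty$ in $\mathrm{Lip}_{\mathrm{loc}}(\Omega)\cap L^{p(\cdot)}(\Omega)$ with $u_i\to u$ in $L^{p(\cdot)}(\Omega)$. Define $\widetilde{\mathrm{BV}}^{p(\cdot)}(\Omega)=\{u\in L^{p(\cdot)}(\Omega):\varrho_{\widetilde{\mathrm{BV}}^{p(\cdot)}}(u)<\infty\}$ and, for $u$ in this space, $$\|u\|_{\widetilde{\mathrm{BV}}^{p(\cdot)}}=\|u\|_{p(\cdot)}+\inf\{\lambda>0:\varrho_{\widetilde{\mathrm{BV}}^{p(\cdot)}}(u/\lambda)\le1\}.$$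 *)

theory Defs
  imports
    "HOL-Analysis.Analysis"
    "HOL-Probability.Essential_Supremum"
    "HOL-Algebra.Module"
    "HOL-Algebra.Algebraic_Closure_Type"
begin

section \<open>Real Banach spaces with an explicit carrier\<close>

text \<open>The underlying vector space is a module over the field of real numbers.\<close>

locale banach_space = module "ring_of_type_algebra :: real ring" V
  for V :: "(real, 'v) module" (structure) +
  fixes nrm :: "'v \<Rightarrow> real"
  assumes nrm_nonneg: "x \<in> carrier V \<Longrightarrow> 0 \<le> nrm x"
    and nrm_eq_0_iff: "x \<in> carrier V \<Longrightarrow> nrm x = 0 \<longleftrightarrow> x = \<zero>"
    and nrm_smult: "x \<in> carrier V \<Longrightarrow> nrm (a \<odot> x) = \<bar>a\<bar> * nrm x"
    and nrm_triangle: "\<lbrakk>x \<in> carrier V; y \<in> carrier V\<rbrakk> \<Longrightarrow> nrm (x \<oplus> y) \<le> nrm x + nrm y"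
    and complete:
      "\<lbrakk>\<And>i. s i \<in> carrier V; \<And>e. e > 0 \<Longrightarrow> \<exists>N. \<forall>i\<ge>N. \<forall>j\<ge>N. nrm (s i \<ominus> s j) < e\<rbrakk>
        \<Longrightarrow> \<exists>x\<in>carrier V. (\<lambda>i::nat. nrm (s i \<ominus> x)) \<longlonglongrightarrow> 0"

section \<open>Variable exponent Lebesgue spaces\<close>

text \<open>Functions on \<open>\<Omega>\<close> are represented by total functions; nothing below depends on their
  values outside \<open>\<Omega>\<close> when \<open>\<Omega>\<close> is open. In this section and the next one \<open>u\<close> is an individual
  function; the identification of functions that agree almost everywhere is made at the end.
  Note that \<open>0 powr p x = 0\<close>, as it should be for \<open>p x \<ge> 1\<close>.\<close>

definition modular :: "'a::euclidean_space set \<Rightarrow> ('a \<Rightarrow> real) \<Rightarrow> ('a \<Rightarrow> real) \<Rightarrow> ennreal" where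
  "modular \<Omega> p u = (\<integral>\<^sup>+x. ennreal (\<bar>u x\<bar> powr p x) \<partial>lebesgue_on \<Omega>)"

definition Lp_var :: "'a::euclidean_space set \<Rightarrow> ('a \<Rightarrow> real) \<Rightarrow> ('a \<Rightarrow> real) set" where
  "Lp_var \<Omega> p = {u \<in> borel_measurable (lebesgue_on \<Omega>). \<exists>l>0. modular \<Omega> p (\<lambda>x. u x / l) < \<infinity>}"

definition Lp_norm :: "'a::euclidean_space set \<Rightarrow> ('a \<Rightarrow> real) \<Rightarrow> ('a \<Rightarrow> real) \<Rightarrow> real" where
  "Lp_norm \<Omega> p u = Inf {l. l > 0 \<and> modular \<Omega> p (\<lambda>x. u x / l) \<le> 1}"

section \<open>The relaxed modular\<close>

definition Lip_loc :: "'a::euclidean_space set \<Rightarrow> ('a \<Rightarrow> real) set" where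
  "Lip_loc \<Omega> = {u. \<forall>x\<in>\<Omega>. \<exists>r>0. \<exists>L. L-lipschitz_on (cball x r \<inter> \<Omega>) u}"

text \<open>The vector of partial derivatives. For a locally Lipschitz function it exists almost
  everywhere and almost everywhere represents the Frechet derivative (Rademacher); the
  unspecified value of \<open>deriv\<close> at the remaining points does not affect integrals.\<close>

definition grad :: "('a::euclidean_space \<Rightarrow> real) \<Rightarrow> 'a \<Rightarrow> 'a" where
  "grad u x = (\<Sum>b\<in>Basis. deriv (\<lambda>t::real. u (x + t *\<^sub>R b)) 0 *\<^sub>R b)"

definition BV_modular :: "'a::euclidean_space set \<Rightarrow> ('a \<Rightarrow> real) \<Rightarrow> ('a \<Rightarrow> real) \<Rightarrow> ennreal" where
  "BV_modular \<Omega> p u =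
     Inf {liminf (\<lambda>i. \<integral>\<^sup>+x. ennreal (norm (grad (us i) x) powr p x) \<partial>lebesgue_on \<Omega>) | us :: nat \<Rightarrow> 'a \<Rightarrow> real.
            (\<forall>i. us i \<in> Lip_loc \<Omega> \<inter> Lp_var \<Omega> p) \<and>
            (\<lambda>i. Lp_norm \<Omega> p (\<lambda>x. us i x - u x)) \<longlonglongrightarrow> 0}"

definition BV_fun :: "'a::euclidean_space set \<Rightarrow> ('a \<Rightarrow> real) \<Rightarrow> ('a \<Rightarrow> real) set" where
  "BV_fun \<Omega> p = {u \<in> Lp_var \<Omega> p. BV_modular \<Omega> p u < \<infinity>}"

definition BV_fun_norm :: "'a::euclidean_space set \<Rightarrow> ('a \<Rightarrow> real) \<Rightarrow> ('a \<Rightarrow> real) \<Rightarrow> real" where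
  "BV_fun_norm \<Omega> p u =
     Lp_norm \<Omega> p u + Inf {l. l > 0 \<and> BV_modular \<Omega> p (\<lambda>x. u x / l) \<le> 1}"

section \<open>Identification of functions that agree almost everywhere\<close>

definition ae_rel :: "'a::euclidean_space set \<Rightarrow> (('a \<Rightarrow> real) \<times> ('a \<Rightarrow> real)) set" where
  "ae_rel \<Omega> = {(u, v). u \<in> borel_measurable (lebesgue_on \<Omega>) \<and> v \<in> borel_measurable (lebesgue_on \<Omega>) \<and>
                  (AE x in lebesgue_on \<Omega>. u x = v x)}"

text \<open>The vector space of equivalence classes. The record type for modules extends the one for
  rings, but the locale for modules does not refer to the fields \<open>mult\<close> and \<open>one\<close>.\<close>

definition BV_space :: "'a::euclidean_space set \<Rightarrow> ('a \<Rightarrow> real) \<Rightarrow> (real, ('a \<Rightarrow> real) set) module" where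
  "BV_space \<Omega> p =
     \<lparr>carrier = BV_fun \<Omega> p // ae_rel \<Omega>,
      mult = undefined,
      one = undefined,
      zero = ae_rel \<Omega> `` {\<lambda>x. 0},
      add = (\<lambda>C D. \<Union>u\<in>C. \<Union>v\<in>D. ae_rel \<Omega> `` {\<lambda>x. u x + v x}),
      smult = (\<lambda>a C. \<Union>u\<in>C. ae_rel \<Omega> `` {\<lambda>x. a * u x})\<rparr>"

text \<open>The common value of the norm on the representatives of a class.\<close>

definition BV_norm :: "'a::euclidean_space set \<Rightarrow> ('a \<Rightarrow> real) \<Rightarrow> ('a \<Rightarrow> real) set \<Rightarrow> real" where
  "BV_norm \<Omega> p C = the_elem (BV_fun_norm \<Omega> p ` C)"

end

theory Submission
  imports Defs
begin

text \<open>Both terms of the norm are Minkowski functionals of convex symmetric sets of functions, so they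
  are seminorms as soon as the two modulars are convex. For the relaxed modular this rests on the
  almost everywhere linearity of the gradient on locally Lipschitz functions. Only the partial
  derivatives are needed for that, so Lebesgue's theorem on the line (via Vitali coverings) together
  with Tonelli replaces Rademacher's theorem. Boundedness of \<open>p\<close> makes finiteness of the relaxed
  modular invariant under scaling. For completeness, a Cauchy sequence converges in the variable
  exponent Lebesgue space, and the relaxed modular is lower semicontinuous there by a diagonal
  argument, so that the limit \<open>j \<rightarrow> \<infinity>\<close> may be taken in \<open>\<rho>((u\<^sub>i - u\<^sub>j) / \<epsilon>) \<le> 1\<close>.\<close>

subsection \<open>Almost everywhere differentiability of Lipschitz functions\<close>

text \<open>Two obstacles shape the development. The infimum in \<open>BV_modular\<close> ranges
  over whole sequences, which is awkward for every estimate. For finite \<open>c\<close> the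
  condition \<open>BV_modular \<Omega> p u \<le> c\<close> is therefore recast: for each
  \<open>e > 0\<close> there is one locally Lipschitz \<open>w\<close> within \<open>e\<close> of
  \<open>u\<close> whose energy is at most \<open>c + e\<close>. In this form convexity, symmetry,
  scaling and semicontinuity become estimates on single functions. The second obstacle is that the
  gradient is meaningful only almost everywhere, and that the exceptional set must be Borel before
  it can be sliced; hence the detour through closed sets of difference quotients. On the line,
  adding a multiple of the identity makes a Lipschitz function strictly increasing with slopes
  bounded away from 0. Small slopes of the function are then large slopes of its inverse, so a
  single covering estimate for images of sets serves both ends of the oscillation.\<close>

lemma strict_mono_image_open_interval:
  fixes f :: "real \<Rightarrow> real"
  assumes "strict_mono f" "continuous_on UNIV f" "u < v"
  shows "f ` {u<..<v} = {f u<..<f v}"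
proof
  show "f ` {u<..<v} \<subseteq> {f u<..<f v}"
    using assms(1) by (auto simp: strict_mono_less)
  show "{f u<..<f v} \<subseteq> f ` {u<..<v}"
  proof
    fix y assume y: "y \<in> {f u<..<f v}"
    have "\<exists>x. u \<le> x \<and> x \<le> v \<and> f x = y"
      using y assms(3) by (intro IVT') (auto intro: continuous_on_subset[OF assms(2)])
    then obtain x where "u \<le> x" "x \<le> v" "f x = y" by blast
    with y have "x \<in> {u<..<v}"
      using assms(1) by (auto simp: order_less_le)
    with \<open>f x = y\<close> show "y \<in> f ` {u<..<v}" by blast
  qed
qed

text \<open>Vitali covering: the straddling intervals of slope at least \<open>q\<close> cover
  \<open>E\<close> finely, so countably many disjoint ones exhaust \<open>E\<close> up to a null
  set. Their images are disjoint intervals at least \<open>q\<close> times as long.\<close>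

lemma emeasure_image_ge_slope:
  fixes f :: "real \<Rightarrow> real"
  assumes mono: "strict_mono f" and cont: "continuous_on UNIV f"
    and E: "E \<in> sets borel" and fE: "f ` E \<in> sets borel" and q: "q > 0"
    and slope: "\<And>x d. \<lbrakk>x \<in> E; d > 0\<rbrakk> \<Longrightarrow> \<exists>u v. u < x \<and> x < v \<and> v - u < d \<and> q * (v - u) \<le> f v - f u"
  shows "ennreal q * emeasure lborel E \<le> emeasure lborel (f ` E)"
proof (rule ennreal_le_epsilon)
  fix e :: real assume e: "e > 0"
  \<comment> \<open>Only intervals inside the preimage of \<open>H\<close> are used, so their images
    overshoot the image of \<open>E\<close> by a set of measure less than \<open>e\<close>.\<close>
  obtain H where H: "open H" "f ` E \<subseteq> H" and He: "emeasure lborel (H - f ` E) < ennreal e"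
    using outer_regular_lborel[OF fE e] by blast
  define G where "G = f -` H"
  have G: "open G" "E \<subseteq> G"
    using H cont unfolding G_def by (auto intro: open_vimage)
  define K where "K = {(u, v). u < v \<and> {u<..<v} \<subseteq> G \<and> q * (v - u) \<le> f v - f u}"
  define a r where "a = (\<lambda>(u, v). (u + v) / 2 :: real)" and "r = (\<lambda>(u, v). (v - u) / 2 :: real)"
  define I where "I = (\<lambda>(u, v). {u<..<v::real})"
  have ball: "ball (a k) (r k) = I k" for k
    by (cases k) (auto simp: a_def r_def I_def ball_eq_greaterThanLessThan field_simps)
  have cover: "\<exists>k. k \<in> K \<and> x \<in> ball (a k) (r k) \<and> r k < d" if x: "x \<in> E" and d: "d > 0" for x d
  proof -
    obtain e where e: "e > 0" "ball x e \<subseteq> G"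
      using G x by (meson openE subset_iff)
    obtain u v where uv: "u < x" "x < v" "v - u < min d e" "q * (v - u) \<le> f v - f u"
      using slope[OF x, of "min d e"] d e by auto
    have "{u<..<v} \<subseteq> ball x e"
      using uv by (auto simp: dist_real_def)
    then have "(u, v) \<in> K"
      using uv e by (auto simp: K_def)
    then show ?thesis
      using uv by (intro exI[of _ "(u, v)"]) (auto simp: ball I_def, auto simp: r_def)
  qed
  obtain C where C: "countable C" "C \<subseteq> K" "pairwise (\<lambda>i j. disjnt (I i) (I j)) C"
    and neg: "negligible (E - (\<Union>i\<in>C. I i))"
    using Vitali_covering_theorem_balls[of E K a r, OF cover] unfolding ball by blast
  have borelI [measurable]: "I k \<in> sets borel" "f ` I k \<in> sets borel" if kC: "k \<in> C" for k
  proof -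
    obtain u v where "k = (u, v)" "u < v" using subsetD[OF C(2) kC] by (auto simp: K_def)
    then show "I k \<in> sets borel" "f ` I k \<in> sets borel"
      by (auto simp: I_def strict_mono_image_open_interval[OF mono cont])
  qed
  have UI: "(\<Union>i\<in>C. I i) \<in> sets borel"
    using C(1) borelI by auto
  have le: "ennreal q * emeasure lborel (I k) \<le> emeasure lborel (f ` I k)" if kC: "k \<in> C" for k
  proof -
    obtain u v where k: "k = (u, v)" "u < v" "q * (v - u) \<le> f v - f u"
      using subsetD[OF C(2) kC] by (auto simp: K_def)
    have "f u \<le> f v" using mono k by (simp add: strict_mono_less_eq)
    then show ?thesis
      using k q by (auto simp: I_def strict_mono_image_open_interval[OF mono cont]
           simp flip: ennreal_mult intro!: ennreal_leI)
  qed
  have disj: "disjoint_family_on I C"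
    using C(3) by (auto simp: disjoint_family_on_def pairwise_def disjnt_def)
  have inj: "inj f" using mono by (rule strict_mono_imp_inj_on)
  have disj': "disjoint_family_on (\<lambda>k. f ` I k) C"
    using disj unfolding disjoint_family_on_def by (metis image_Int[OF inj] image_empty)
  have "ennreal q * emeasure lborel E \<le> ennreal q * emeasure lborel (\<Union>i\<in>C. I i)"
  proof (intro mult_left_mono)
    have "E - (\<Union>i\<in>C. I i) \<in> null_sets lborel"
      using neg E UI by (auto simp: negligible_iff_null_sets null_sets_completion_iff)
    then have "emeasure lborel E \<le> emeasure lborel ((\<Union>i\<in>C. I i) \<union> (E - (\<Union>i\<in>C. I i)))"
      using E UI by (intro emeasure_mono) auto
    also have "\<dots> = emeasure lborel (\<Union>i\<in>C. I i)"
      using E UI \<open>_ \<in> null_sets lborel\<close> by (intro emeasure_Un_null_set) auto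
    finally show "emeasure lborel E \<le> emeasure lborel (\<Union>i\<in>C. I i)" .
  qed simp
  also have "\<dots> = ennreal q * (\<integral>\<^sup>+k. emeasure lborel (I k) \<partial>count_space C)"
    using C(1) disj by (subst emeasure_UN_countable) auto
  also have "\<dots> = (\<integral>\<^sup>+k. ennreal q * emeasure lborel (I k) \<partial>count_space C)"
    by (simp add: nn_integral_cmult)
  also have "\<dots> \<le> (\<integral>\<^sup>+k. emeasure lborel (f ` I k) \<partial>count_space C)"
    using le by (intro nn_integral_mono) auto
  also have "\<dots> = emeasure lborel (\<Union>k\<in>C. f ` I k)"
    using C(1) disj' by (subst emeasure_UN_countable) auto
  also have "\<dots> \<le> emeasure lborel H"
    using C(2) H by (intro emeasure_mono) (auto simp: K_def G_def I_def)
  also have "\<dots> = emeasure lborel (f ` E \<union> (H - f ` E))"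
    using H by (simp add: Un_absorb1)
  also have "\<dots> \<le> emeasure lborel (f ` E) + emeasure lborel (H - f ` E)"
    using H fE by (intro emeasure_subadditive) auto
  also have "\<dots> \<le> emeasure lborel (f ` E) + ennreal e"
    using He by (intro add_left_mono) auto
  finally show "ennreal q * emeasure lborel E \<le> emeasure lborel (f ` E) + ennreal e" .
qed

text \<open>Slopes of at least 1 make \<open>h\<close> a bijection of the line with a 1-Lipschitz
  inverse \<open>g\<close>, so the image estimate applies to both. Where slopes above
  \<open>q\<close> and below \<open>p\<close> persist at all scales, it gives
  \<open>q * m \<le> p * m\<close> for the measure \<open>m\<close> of a bounded piece, and
  \<open>p < q\<close> forces \<open>m = 0\<close>.\<close>

lemma strictly_expanding_bilipschitz_differentiable_AE:
  fixes h :: "real \<Rightarrow> real"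
  assumes lo: "\<And>x y. x < y \<Longrightarrow> y - x \<le> h y - h x" and hi: "\<And>x y. x < y \<Longrightarrow> h y - h x \<le> M * (y - x)"
  shows "negligible {x. \<not> h differentiable at x}"
proof -
  define g where "g = inv_into UNIV h"
  have M: "M \<ge> 1" using lo[of 0 1] hi[of 0 1] by simp
  have mono: "strict_mono h"
    using lo by (intro strict_monoI) (smt (verit))
  have hlip: "\<bar>h y - h x\<bar> \<le> M * \<bar>y - x\<bar>" for x y
    using lo[of x y] hi[of x y] lo[of y x] hi[of y x] by (cases x y rule: linorder_cases) auto
  have cont: "continuous_on UNIV h"
    using hlip M
    by (intro lipschitz_on_continuous_on[of M] lipschitz_onI) (auto simp: dist_real_def abs_minus_commute)
  have "surj h"
    unfolding surj_def
  proof
    fix y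
    define R where "R = \<bar>y - h 0\<bar> + 1"
    have "R > 0" by (simp add: R_def)
    have "\<exists>x. -R \<le> x \<and> x \<le> R \<and> h x = y"
    proof (intro IVT')
      show "h (-R) \<le> y" using lo[of "-R" 0] \<open>R > 0\<close> unfolding R_def by linarith
      show "y \<le> h R" using lo[of 0 R] \<open>R > 0\<close> unfolding R_def by linarith
    qed (use \<open>R > 0\<close> in \<open>auto intro: continuous_on_subset[OF cont]\<close>)
    then show "\<exists>x. y = h x" by blast
  qed
  have inj: "inj h" using mono by (rule strict_mono_imp_inj_on)
  have gh [simp]: "g (h x) = x" for x by (simp add: g_def inj)
  have hg [simp]: "h (g x) = x" for x by (simp add: g_def \<open>surj h\<close> surj_f_inv_f)
  have gmono: "strict_mono g"
    by (intro strict_monoI) (metis hg mono strict_mono_less)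
  have "\<bar>g y - g x\<bar> \<le> \<bar>y - x\<bar>" for x y
    using lo[of "g x" "g y"] lo[of "g y" "g x"] by (cases "g x" "g y" rule: linorder_cases) auto
  then have gcont: "continuous_on UNIV g"
    by (intro lipschitz_on_continuous_on[of 1] lipschitz_onI) (auto simp: dist_real_def abs_minus_commute)
  have image: "h ` E = g -` E" for E
    by (auto simp: image_iff) (metis hg)
  \<comment> \<open>Straddling intervals make \<open>U\<close> and \<open>L\<close> open, so no measurability of Dini derivatives is needed.\<close>
  define U where "U q d = (\<Union>(u, v)\<in>{(u, v). u < v \<and> v - u < d \<and> q * (v - u) < h v - h u}. {u<..<v})" for q d
  define L where "L q d = (\<Union>(u, v)\<in>{(u, v). u < v \<and> v - u < d \<and> h v - h u < q * (v - u)}. {u<..<v})" for q d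
  \<comment> \<open>Here straddling slopes oscillate across \<open>p < q\<close> at every scale. The
    cut-off \<open>K\<close> makes the measure finite, without which comparing it with a multiple of
    itself would say nothing.\<close>
  define E where "E p q K = (\<Inter>n::nat. U q (1 / Suc n) \<inter> L p (1 / Suc n)) \<inter> {-real K..real K}" for p q and K :: nat
  have null: "E p q K \<in> null_sets lborel" if pq: "0 < p" "p < q" for p q K
  proof -
    have openUL: "open (U q d)" "open (L q d)" for q d
      unfolding U_def L_def by auto
    have E: "E p q K \<in> sets borel"
      unfolding E_def using openUL by (intro sets.Int sets.countable_INT'') auto
    have hE: "h ` E p q K \<in> sets borel"
      unfolding image using E gcont
      by (metis borel_measurable_continuous_onI measurable_sets_borel)
    have d: "\<exists>n. 1 / real (Suc n) < d" if "d > 0" for d :: real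
      using nat_approx_posE[OF that] by blast
    have 1: "ennreal q * emeasure lborel (E p q K) \<le> emeasure lborel (h ` E p q K)"
    proof (rule emeasure_image_ge_slope[OF mono cont E hE])
      fix x d :: real assume x: "x \<in> E p q K" and "d > 0"
      obtain n where n: "1 / real (Suc n) < d" using d[OF \<open>d > 0\<close>] by blast
      have "x \<in> U q (1 / Suc n)" using x by (auto simp: E_def)
      then show "\<exists>u v. u < x \<and> x < v \<and> v - u < d \<and> q * (v - u) \<le> h v - h u"
        using n by (fastforce simp: U_def)
    qed (use pq in auto)
    \<comment> \<open>The bound for small slopes of \<open>h\<close> is the bound for large slopes of its inverse.\<close>
    have 2: "ennreal (1 / p) * emeasure lborel (h ` E p q K) \<le> emeasure lborel (g ` (h ` E p q K))"
    proof (rule emeasure_image_ge_slope[OF gmono gcont hE])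
      fix y d :: real assume y: "y \<in> h ` E p q K" and "d > 0"
      then obtain x where x: "x \<in> E p q K" "y = h x" by blast
      \<comment> \<open>Lengths grow by a factor of at most \<open>M\<close> under \<open>h\<close>,
        so an interval shorter than \<open>d / M\<close> has an image shorter than
        \<open>d\<close>.\<close>
      have "d / M > 0" using \<open>d > 0\<close> M by simp
      then obtain n where n: "1 / real (Suc n) < d / M" using d by blast
      have "x \<in> L p (1 / Suc n)" using x by (auto simp: E_def)
      then obtain u v where uv: "u < x" "x < v" "v - u < 1 / real (Suc n)" "h v - h u < p * (v - u)"
        by (auto simp: L_def)
      have "M * (v - u) < M * (d / M)"
        using uv n M by (intro mult_strict_left_mono) auto
      then have "h v - h u < d" using hi[of u v] uv M by simp
      then show "\<exists>u v. u < y \<and> y < v \<and> v - u < d \<and> 1 / p * (v - u) \<le> g v - g u"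
        using uv x pq mono by (intro exI[of _ "h u"] exI[of _ "h v"]) (auto simp: strict_mono_less field_simps)
    qed (use pq E in \<open>auto simp: image_image\<close>)
    have fin: "emeasure lborel (E p q K) < \<infinity>"
    proof -
      have "emeasure lborel (E p q K) \<le> emeasure lborel {-real K..real K}"
        by (intro emeasure_mono) (auto simp: E_def)
      then show ?thesis by (simp add: ennreal_less_top le_less_trans top.not_eq_extremum)
    qed
    then obtain m where m: "emeasure lborel (E p q K) = ennreal m" "m \<ge> 0"
      by (cases "emeasure lborel (E p q K)") auto
    have "ennreal (1 / p) * (ennreal q * emeasure lborel (E p q K)) \<le> emeasure lborel (E p q K)"
      using order_trans[OF mult_left_mono[OF 1] 2] by (simp add: image_image)
    then have "1 / p * (q * m) \<le> m"
      using m pq by (simp flip: ennreal_mult)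
    then have "m * (q - p) \<le> 0" using pq by (simp add: field_simps)
    then have "m = 0" using pq m by (simp add: mult_le_0_iff)
    then show ?thesis using E m by auto
  qed
  define N where "N = (\<Union>p\<in>{0<..} \<inter> \<rat>. \<Union>q\<in>{p<..} \<inter> \<rat>. \<Union>K. E p q K)"
  have N: "negligible N"
  proof -
    have "N \<in> null_sets lborel"
      unfolding N_def by (intro null_sets_UN' countable_Int2 countable_rat null) auto
    then show ?thesis by (simp add: negligible_iff_null_sets null_sets_completionI)
  qed
  have "h differentiable at x" if xN: "x \<notin> N" for x
  proof -
    define Q where "Q u v = (h v - h u) / (v - u)" for u v
    have Q1: "1 \<le> Q u v" "Q u v \<le> M" if "u < v" for u v
      using lo[OF that] hi[OF that] that by (auto simp: Q_def field_simps)
    define S where "S d = {Q u v | u v. u < x \<and> x < v \<and> v - u < d}" for d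
    \<comment> \<open>\<open>A\<close> and \<open>B\<close> collect the eventual upper and lower
      bounds of the straddling quotients: \<open>Inf A\<close> is their upper limit and
      \<open>Sup B\<close> their lower limit as the interval shrinks to \<open>x\<close>.\<close>
    define A where "A = {c. \<exists>d>0. \<forall>s\<in>S d. s \<le> c}"
    define B where "B = {c. \<exists>d>0. \<forall>s\<in>S d. c \<le> s}"
    have SM: "1 \<le> s" "s \<le> M" if "s \<in> S d" for s d
      using that Q1 by (force simp: S_def)+
    have Sne: "\<exists>s. s \<in> S d" if "d > 0" for d
    proof -
      have "Q (x - d / 3) (x + d / 3) \<in> S d" using that unfolding S_def by fastforce
      then show ?thesis by blast
    qed
    have MA: "M \<in> A" and B1: "1 \<in> B"
      unfolding A_def B_def using SM by (auto intro!: exI[of _ 1])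
    have lowA: "1 \<le> c" if "c \<in> A" for c
      using that SM(1) Sne order_trans[of 1 _ c] unfolding A_def by blast
    have upB: "c \<le> M" if "c \<in> B" for c
      using that SM(2) Sne order_trans[of c _ M] unfolding B_def by blast
    have bdd: "bdd_below A" "bdd_above B"
      using lowA upB by (auto simp: bdd_below_def bdd_above_def)
    define D where "D = Inf A"
    have "D \<le> Sup B"
    proof (rule ccontr)
      assume "\<not> D \<le> Sup B"
      \<comment> \<open>A gap between the two limits contains rationals \<open>p < q\<close>, which
        puts \<open>x\<close> into one of the countably many null sets that form
        \<open>N\<close>.\<close>
      then obtain p where p: "p \<in> \<rat>" "Sup B < p" "p < D" using Rats_dense_in_real[of "Sup B" D] by auto
      then obtain q where q: "q \<in> \<rat>" "p < q" "q < D" using Rats_dense_in_real[of p D] by auto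
      have "1 \<le> Sup B" using B1 bdd(2) by (rule cSup_upper)
      then have "p > 0" using p by linarith
      have "q \<notin> A" using q bdd cInf_lower[of q A] by (auto simp: D_def)
      then have q': "\<exists>s\<in>S d. q < s" if "d > 0" for d using that by (force simp: A_def)
      have "p \<notin> B" using p bdd cSup_upper[of p B] by auto
      then have p': "\<exists>s\<in>S d. s < p" if "d > 0" for d using that by (force simp: B_def)
      obtain K :: nat where K: "\<bar>x\<bar> \<le> K" using real_arch_simple by blast
      have "x \<in> U q d" if d: "d > 0" for d
      proof -
        obtain u v where uv: "u < x" "x < v" "v - u < d" "q < Q u v"
          using q'[OF d] by (auto simp: S_def)
        then have "q * (v - u) < h v - h u"
          unfolding Q_def by (subst (asm) pos_less_divide_eq) auto
        with uv show ?thesis unfolding U_def by (intro UN_I[of "(u, v)"]) auto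
      qed
      moreover have "x \<in> L p d" if d: "d > 0" for d
      proof -
        obtain u v where uv: "u < x" "x < v" "v - u < d" "Q u v < p"
          using p'[OF d] by (auto simp: S_def)
        then have "h v - h u < p * (v - u)"
          unfolding Q_def by (subst (asm) pos_divide_less_eq) auto
        with uv show ?thesis unfolding L_def by (intro UN_I[of "(u, v)"]) auto
      qed
      ultimately have "x \<in> E p q K" using K by (auto simp: E_def)
      with xN show False
        using p q \<open>p > 0\<close> unfolding N_def by auto
    qed
    have key: "\<exists>d>0. \<forall>s\<in>S d. \<bar>s - D\<bar> \<le> \<epsilon>" if \<epsilon>: "\<epsilon> > 0" for \<epsilon>
    proof -
      have "Inf A < D + \<epsilon>" using \<epsilon> by (simp add: D_def)
      then obtain a where a: "a \<in> A" "a < D + \<epsilon>" using MA cInf_lessD[of A] by blast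
      have "D - \<epsilon> < Sup B" using \<epsilon> \<open>D \<le> Sup B\<close> by linarith
      then obtain b where b: "b \<in> B" "D - \<epsilon> < b" using B1 less_cSupE[of "D - \<epsilon>" B] by blast
      obtain d d' where d: "d > 0" "\<forall>s\<in>S d. s \<le> a" "d' > 0" "\<forall>s\<in>S d'. b \<le> s"
        using a b by (auto simp: A_def B_def)
      have "S (min d d') \<subseteq> S d \<inter> S d'" by (auto simp: S_def)
      then show ?thesis using d a b by (intro exI[of _ "min d d'"]) fastforce
    qed
    have hc: "(h \<longlongrightarrow> h x) (at x within T)" for T
      using cont by (meson continuous_on_eq_continuous_within continuous_within continuous_within_subset UNIV_I subset_UNIV)
    have "((\<lambda>y. (h y - h x) / (y - x)) \<longlongrightarrow> D) (at x)"
    proof (rule tendstoI)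
      fix \<epsilon> :: real assume "\<epsilon> > 0"
      \<comment> \<open>The bound by \<open>e\<close> survives the limits below only as a weak
        inequality, hence a value strictly under \<open>\<epsilon>\<close>.\<close>
      then obtain e where e: "0 < e" "e < \<epsilon>" using dense by blast
      then obtain d where d: "d > 0" "\<forall>s\<in>S d. \<bar>s - D\<bar> \<le> e" using key[of e] by auto
      have dQ: "\<bar>Q u v - D\<bar> \<le> e" if "u < x" "x < v" "v - u < d" for u v
        using d(2) that by (auto simp: S_def)
      have "\<bar>(h y - h x) / (y - x) - D\<bar> \<le> e" if y: "y \<noteq> x" "\<bar>y - x\<bar> < d" for y
      proof (cases "y > x")
        case True
        \<comment> \<open>Straddling quotients control one-sided ones: \<open>u\<close> tends to
          \<open>x\<close> from the left while \<open>y\<close> stays fixed, and \<open>h\<close> is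
          continuous.\<close>
        have "((\<lambda>u. \<bar>Q u y - D\<bar>) \<longlongrightarrow> \<bar>Q x y - D\<bar>) (at_left x)"
          unfolding Q_def using True by (intro tendsto_intros hc) auto
        moreover have "\<forall>\<^sub>F u in at_left x. \<bar>Q u y - D\<bar> \<le> e"
          using y True unfolding eventually_at_left_field
          by (intro exI[of _ "y - d"]) (auto intro!: dQ)
        ultimately show ?thesis
          unfolding Q_def by (rule tendsto_upperbound) simp
      next
        case False
        have "((\<lambda>v. \<bar>Q y v - D\<bar>) \<longlongrightarrow> \<bar>Q y x - D\<bar>) (at_right x)"
          unfolding Q_def using False y by (intro tendsto_intros hc) auto
        moreover have "\<forall>\<^sub>F v in at_right x. \<bar>Q y v - D\<bar> \<le> e"
          using y False unfolding eventually_at_right_field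
          by (intro exI[of _ "y + d"]) (auto intro!: dQ)
        ultimately have "\<bar>Q y x - D\<bar> \<le> e"
          by (rule tendsto_upperbound) simp
        moreover have "Q y x = (h y - h x) / (y - x)"
          unfolding Q_def by (metis minus_diff_eq minus_divide_divide)
        ultimately show ?thesis by simp
      qed
      then show "\<forall>\<^sub>F y in at x. dist ((h y - h x) / (y - x)) D < \<epsilon>"
        unfolding eventually_at using d e
        by (intro exI[of _ d]) (force simp: dist_real_def)
    qed
    then have "(h has_field_derivative D) (at x)"
      by (simp add: has_field_derivative_iff)
    then show ?thesis
      by (auto simp: differentiable_def has_field_derivative_def)
  qed
  then have "{x. \<not> h differentiable at x} \<subseteq> N" by auto
  then show ?thesis by (rule negligible_subset[OF N])
qed

text \<open>Adding \<open>(L + 1) * x\<close> moves all slopes from \<open>[-L, L]\<close> into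
  \<open>[1, 2 * L + 1]\<close> and does not affect differentiability.\<close>

lemma lipschitz_differentiable_AE:
  fixes f :: "real \<Rightarrow> real"
  assumes f: "L-lipschitz_on UNIV f"
  shows "negligible {x. \<not> f differentiable at x}"
proof -
  define h where "h = (\<lambda>x. f x + (L + 1) * x)"
  have lip: "\<bar>f y - f x\<bar> \<le> L * \<bar>y - x\<bar>" for x y
    using lipschitz_onD[OF f, of y x] by (simp add: dist_real_def)
  have "negligible {x. \<not> h differentiable at x}"
  proof (rule strictly_expanding_bilipschitz_differentiable_AE)
    show "y - x \<le> h y - h x" "h y - h x \<le> (2 * L + 1) * (y - x)" if "x < y" for x y
      using lip[of x y] that by (auto simp: h_def abs_le_iff algebra_simps)
  qed
  moreover have "f differentiable at x" if "h differentiable at x" for x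
  proof -
    have "(\<lambda>x. h x - (L + 1) * x) differentiable at x"
      using that by (intro derivative_intros) auto
    then show ?thesis by (simp add: h_def)
  qed
  ultimately show ?thesis
    by (elim negligible_subset) auto
qed

text \<open>Negligibility is a local property, and near each point \<open>f\<close> agrees with its
  composition with the clamping map \<open>c\<close> onto a small interval, which is Lipschitz on
  the whole line.\<close>

lemma locally_lipschitz_differentiable_AE:
  fixes f :: "real \<Rightarrow> real"
  assumes S: "open S" and f: "f \<in> Lip_loc S"
  shows "negligible {x \<in> S. \<not> f differentiable at x}"
proof (subst locally_negligible_alt, intro ballI)
  let ?N = "{x \<in> S. \<not> f differentiable at x}"
  fix x assume x: "x \<in> ?N"
  then obtain r L where r: "r > 0" and L: "L-lipschitz_on (cball x r \<inter> S) f"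
    using f by (auto simp: Lip_loc_def)
  obtain d where d: "d > 0" "cball x d \<subseteq> S"
    using x S open_contains_cball by blast
  define e where "e = min d r"
  have e: "e > 0" "cball x e \<subseteq> cball x r \<inter> S"
    using d r by (auto simp: e_def)
  define c where "c y = max (x - e) (min (x + e) y)" for y
  have c: "c y \<in> cball x e" "\<bar>c y - c z\<bar> \<le> \<bar>y - z\<bar>" for y z
    using e(1) by (auto simp: c_def dist_real_def)
  have "0 \<le> L" using L lipschitz_on_nonneg by blast
  have "L-lipschitz_on UNIV (\<lambda>y. f (c y))"
  proof (rule lipschitz_onI)
    fix y z
    have "dist (f (c y)) (f (c z)) \<le> L * dist (c y) (c z)"
      using L e c by (intro lipschitz_onD) auto
    also have "\<dots> \<le> L * dist y z"
      using c \<open>0 \<le> L\<close> by (intro mult_left_mono) (auto simp: dist_real_def)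
    finally show "dist (f (c y)) (f (c z)) \<le> L * dist y z" .
  qed fact
  then have neg: "negligible {y. \<not> (\<lambda>y. f (c y)) differentiable at y}"
    by (rule lipschitz_differentiable_AE)
  have "f differentiable at y" if y: "y \<in> ball x e" "(\<lambda>y. f (c y)) differentiable at y" for y
  proof -
    obtain D where "((\<lambda>y. f (c y)) has_derivative D) (at y)"
      using y by (auto simp: differentiable_def)
    then have "(f has_derivative D) (at y)"
      by (rule has_derivative_transform_within_open[of _ _ _ _ "ball x e"])
         (use y in \<open>auto simp: c_def dist_real_def\<close>)
    then show ?thesis by (auto simp: differentiable_def)
  qed
  then have "negligible (?N \<inter> ball x e)"
    by (intro negligible_subset[OF neg]) auto
  then show "\<exists>U. openin (top_of_set ?N) U \<and> x \<in> U \<and> negligible U"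
    using x e by (intro exI[of _ "?N \<inter> ball x e"]) (auto simp: openin_open)
qed

text \<open>Moving a set along a line does not change its measure, so by Tonelli it is enough to know
  the measure of the slices parallel to a single direction.\<close>

lemma null_set_if_slices_null:
  fixes N :: "'a::euclidean_space set"
  assumes N [measurable]: "N \<in> sets borel" and slice: "\<And>x. negligible {t::real. x + t *\<^sub>R b \<in> N}"
  shows "N \<in> null_sets lborel"
proof -
  \<comment> \<open>The cut-off to \<open>{0..1}\<close> has integral one; it writes the measure as
    an average over translates, to which Tonelli applies.\<close>
  have "emeasure lborel N = (\<integral>\<^sup>+t. emeasure lborel N * indicator {0..1} t \<partial>(lborel :: real measure))"
    by (simp add: nn_integral_cmult)
  also have "\<dots> = (\<integral>\<^sup>+t. (\<integral>\<^sup>+x. indicator N (t *\<^sub>R b + x) * indicator {0..1} t \<partial>lborel) \<partial>(lborel :: real measure))"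
  proof (intro nn_integral_cong)
    fix t :: real
    have "emeasure lborel N = (\<integral>\<^sup>+x. indicator N x \<partial>distr lborel borel ((+) (t *\<^sub>R b)))"
      unfolding lborel_distr_plus by simp
    also have "\<dots> = (\<integral>\<^sup>+x. indicator N (t *\<^sub>R b + x) \<partial>lborel)"
      by (subst nn_integral_distr) auto
    finally show "emeasure lborel N * indicator {0..1} t = (\<integral>\<^sup>+x. indicator N (t *\<^sub>R b + x) * indicator {0..1} t \<partial>lborel)"
      by (simp add: nn_integral_multc)
  qed
  also have "\<dots> = (\<integral>\<^sup>+x. (\<integral>\<^sup>+t. indicator N (t *\<^sub>R b + x) * indicator {0..1} t \<partial>(lborel :: real measure)) \<partial>lborel)"
    by (rule lborel_pair.Fubini') measurable
  also have "\<dots> = (\<integral>\<^sup>+x. 0 \<partial>(lborel :: 'a measure))"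
  proof (intro nn_integral_cong)
    fix x :: 'a
    have [measurable]: "{t. x + t *\<^sub>R b \<in> N} \<in> sets borel" by measurable
    have "{t. x + t *\<^sub>R b \<in> N} \<in> null_sets lborel"
      using slice[of x] by (auto simp: negligible_iff_null_sets null_sets_completion_iff)
    then have "AE t in (lborel :: real measure). t \<notin> {t. x + t *\<^sub>R b \<in> N}"
      by (rule AE_not_in)
    then show "(\<integral>\<^sup>+t. indicator N (t *\<^sub>R b + x) * indicator {0..1} t \<partial>(lborel :: real measure)) = 0"
      by (subst nn_integral_0_iff_AE) (auto simp: add.commute elim: eventually_mono)
  qed
  finally show ?thesis by (simp add: null_sets_def)
qed

text \<open>Thresholds indexed by natural numbers turn the existence of a derivative into a
  countable combination of conditions on difference quotients, and the weak inequality at the end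
  makes these conditions closed.\<close>

lemma tendsto_at_0_iff_Cauchy:
  fixes q :: "real \<Rightarrow> real"
  shows "(\<exists>D. (q \<longlongrightarrow> D) (at 0)) \<longleftrightarrow>
    (\<forall>k::nat. \<exists>m::nat. \<forall>s t. s \<noteq> 0 \<longrightarrow> t \<noteq> 0 \<longrightarrow> \<bar>s\<bar> < 1 / Suc m \<longrightarrow> \<bar>t\<bar> < 1 / Suc m \<longrightarrow> \<bar>q s - q t\<bar> \<le> 1 / Suc k)"
    (is "_ \<longleftrightarrow> (\<forall>k. \<exists>m. ?P k m)")
proof safe
  fix D and k :: nat assume D: "(q \<longlongrightarrow> D) (at 0)"
  define c where "c = 1 / real (Suc k)"
  have "c > 0" by (simp add: c_def)
  then have "\<forall>\<^sub>F t in at 0. dist (q t) D < c / 2"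
    using D by (intro tendstoD) simp_all
  then obtain d where d: "d > 0" "\<And>t. t \<noteq> 0 \<Longrightarrow> \<bar>t\<bar> < d \<Longrightarrow> \<bar>q t - D\<bar> < c / 2"
    unfolding eventually_at by (auto simp: dist_real_def)
  obtain m where m: "1 / real (Suc m) < d" using nat_approx_posE[OF d(1)] by blast
  then have "\<bar>q s - q t\<bar> \<le> 1 / Suc k" if "s \<noteq> 0" "t \<noteq> 0" "\<bar>s\<bar> < 1 / Suc m" "\<bar>t\<bar> < 1 / Suc m" for s t
  proof -
    have "\<bar>q s - D\<bar> < c / 2" and "\<bar>q t - D\<bar> < c / 2"
      using that m by (intro d(2); linarith)+
    then show ?thesis unfolding c_def[symmetric] by argo
  qed
  then show "\<exists>m. ?P k m" by blast
next
  assume *: "\<forall>k. \<exists>m. ?P k m"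
  \<comment> \<open>The factor 2 keeps the sample point strictly inside the radius
    \<open>1 / Suc m\<close> even for \<open>n = m\<close>.\<close>
  define x where "x n = q (1 / (2 * Suc n))" for n :: nat
  have small: "\<bar>1 / (2 * Suc n)\<bar> < 1 / real (Suc m)" if "m \<le> n" for m n
    using that by (simp add: field_simps)
  have "Cauchy x"
  proof (rule CauchyI)
    fix e :: real assume "e > 0"
    obtain k where k: "1 / Suc k < e" using nat_approx_posE[OF \<open>e > 0\<close>] by blast
    obtain m where m: "?P k m" using * by blast
    show "\<exists>M. \<forall>i\<ge>M. \<forall>j\<ge>M. norm (x i - x j) < e"
    proof (intro exI[of _ m] allI impI)
      fix i j assume "m \<le> i" "m \<le> j"
      then have "\<bar>x i - x j\<bar> \<le> 1 / Suc k"
        unfolding x_def by (intro m[rule_format] small) auto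
      then show "norm (x i - x j) < e" using k by simp
    qed
  qed
  then obtain D where D: "x \<longlonglongrightarrow> D" using Cauchy_convergent convergent_def by blast
  have "(q \<longlongrightarrow> D) (at 0)"
  proof (rule tendstoI)
    fix e :: real assume "e > 0"
    obtain k where k: "1 / Suc k < e" using nat_approx_posE[OF \<open>e > 0\<close>] by blast
    obtain m where m: "?P k m" using * by blast
    have "\<bar>q t - D\<bar> \<le> 1 / Suc k" if "t \<noteq> 0" "\<bar>t\<bar> < 1 / Suc m" for t
    proof (rule tendsto_upperbound[of _ _ sequentially])
      show "(\<lambda>n. \<bar>q t - x n\<bar>) \<longlonglongrightarrow> \<bar>q t - D\<bar>" by (intro tendsto_intros D)
      show "\<forall>\<^sub>F n in sequentially. \<bar>q t - x n\<bar> \<le> 1 / Suc k"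
        unfolding x_def using that by (intro eventually_sequentiallyI[of m] m[rule_format] small) auto
    qed simp
    then show "\<forall>\<^sub>F t in at 0. dist (q t) D < e"
      unfolding eventually_at using k by (intro exI[of _ "1 / Suc m"]) (auto simp: dist_real_def intro: le_less_trans)
  qed
  then show "\<exists>D. (q \<longlongrightarrow> D) (at 0)" by blast
qed

lemma Lip_loc_continuous_on:
  assumes \<Omega>: "open \<Omega>" and u: "u \<in> Lip_loc \<Omega>"
  shows "continuous_on \<Omega> u"
  unfolding continuous_on_eq_continuous_at[OF \<Omega>]
proof
  fix x assume x: "x \<in> \<Omega>"
  then obtain r L where r: "r > 0" and L: "L-lipschitz_on (cball x r \<inter> \<Omega>) u"
    using u by (auto simp: Lip_loc_def)
  have "x \<in> interior (cball x r \<inter> \<Omega>)"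
    using x r \<Omega> by (simp add: interior_open)
  then show "isCont u x"
    using lipschitz_on_continuous_on[OF L] continuous_on_interior by blast
qed

lemma Lip_loc_slice:
  fixes x b :: "'a::euclidean_space"
  assumes "u \<in> Lip_loc \<Omega>" "norm b = 1"
  shows "(\<lambda>t. u (x + t *\<^sub>R b)) \<in> Lip_loc {t. x + t *\<^sub>R b \<in> \<Omega>}"
  unfolding Lip_loc_def
proof safe
  fix t assume t: "x + t *\<^sub>R b \<in> \<Omega>"
  then obtain r L where r: "r > 0" and L: "L-lipschitz_on (cball (x + t *\<^sub>R b) r \<inter> \<Omega>) u"
    using assms by (auto simp: Lip_loc_def)
  have dist: "dist (x + s *\<^sub>R b) (x + s' *\<^sub>R b) = dist s s'" for s s'
    using assms(2) by (simp add: dist_norm flip: scaleR_diff_left)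
  have "L-lipschitz_on (cball t r \<inter> {t. x + t *\<^sub>R b \<in> \<Omega>}) (\<lambda>t. u (x + t *\<^sub>R b))"
  proof (rule lipschitz_onI)
    fix s s' assume "s \<in> cball t r \<inter> {t. x + t *\<^sub>R b \<in> \<Omega>}" "s' \<in> cball t r \<inter> {t. x + t *\<^sub>R b \<in> \<Omega>}"
    then show "dist (u (x + s *\<^sub>R b)) (u (x + s' *\<^sub>R b)) \<le> L * dist s s'"
      using lipschitz_onD[OF L, of "x + s *\<^sub>R b" "x + s' *\<^sub>R b"] by (simp add: dist del: dist_add_cancel)
  qed (rule lipschitz_on_nonneg[OF L])
  with r show "\<exists>r>0. \<exists>L. L-lipschitz_on (cball t r \<inter> {t. x + t *\<^sub>R b \<in> \<Omega>}) (\<lambda>t. u (x + t *\<^sub>R b))"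
    by blast
qed

text \<open>On each line parallel to \<open>b\<close> the exceptional set is null by the
  one-dimensional result. Most of the work is to show that this set is Borel, as slicing
  requires.\<close>

lemma Lip_loc_directional_derivative_AE:
  fixes b :: "'a::euclidean_space"
  assumes \<Omega>: "open \<Omega>" and u: "u \<in> Lip_loc \<Omega>" and b: "norm b = 1"
  shows "AE x in lebesgue_on \<Omega>. (\<lambda>t. u (x + t *\<^sub>R b)) differentiable at 0"
proof -
  define Q where "Q x t = (u (x + t *\<^sub>R b) - u x) / t" for x t
  \<comment> \<open>On the closed set \<open>F m\<close> all quotients with small increments are continuous, so \<open>C k m\<close> is closed although
    it is an uncountable intersection.\<close>
  define F where "F m = {x. \<forall>z. z \<notin> \<Omega> \<longrightarrow> 1 / Suc m \<le> dist x z}" for m :: nat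
  have closedF: "closed (F m)" for m
    unfolding F_def by (intro closed_Collect_all closed_Collect_imp closed_Collect_le continuous_intros) auto
  have F\<Omega>: "x + t *\<^sub>R b \<in> \<Omega>" if "x \<in> F m" "\<bar>t\<bar> < 1 / Suc m" for x t m
  proof (rule ccontr)
    assume "x + t *\<^sub>R b \<notin> \<Omega>"
    then have "1 / Suc m \<le> dist x (x + t *\<^sub>R b)" using that(1) unfolding F_def by blast
    then show False using that(2) b by (simp add: dist_norm)
  qed
  define D where "D = {x \<in> \<Omega>. \<exists>D. (Q x \<longlongrightarrow> D) (at 0)}"
  define P where "P k m q \<longleftrightarrow> (\<forall>s t. s \<noteq> 0 \<longrightarrow> t \<noteq> 0 \<longrightarrow> \<bar>s\<bar> < 1 / Suc m \<longrightarrow> \<bar>t\<bar> < 1 / Suc m \<longrightarrow>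
      \<bar>q s - q t\<bar> \<le> 1 / Suc k)" for k m :: nat and q :: "real \<Rightarrow> real"
  define C where "C k m = {x \<in> F m. P k m (Q x)}" for k m :: nat
  have D_iff: "x \<in> D \<longleftrightarrow> x \<in> \<Omega> \<and> (\<forall>k. \<exists>m. P k m (Q x))" for x
    unfolding D_def P_def tendsto_at_0_iff_Cauchy by (rule mem_Collect_eq)
  have closedC: "closed (C k m)" for k m
  proof -
    have contQ: "continuous_on (F m) (\<lambda>x. Q x s)" if "s \<noteq> 0" "\<bar>s\<bar> < 1 / Suc m" for s
      unfolding Q_def using that F\<Omega>[of _ m s] F\<Omega>[of _ m 0]
      by (intro continuous_intros continuous_on_compose2[OF Lip_loc_continuous_on[OF \<Omega> u]]) auto
    have "closed {x \<in> F m. \<bar>Q x s - Q x t\<bar> \<le> 1 / Suc k}"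
      if "s \<noteq> 0" "\<bar>s\<bar> < 1 / Suc m" "t \<noteq> 0" "\<bar>t\<bar> < 1 / Suc m" for s t
      using that closedF by (intro continuous_on_closed_Collect_le continuous_intros contQ)
    moreover have "C k m = F m \<inter> (\<Inter>(s, t)\<in>{(s, t). s \<noteq> 0 \<and> \<bar>s\<bar> < 1 / Suc m \<and> t \<noteq> 0 \<and> \<bar>t\<bar> < 1 / Suc m}.
        {x \<in> F m. \<bar>Q x s - Q x t\<bar> \<le> 1 / Suc k})"
      by (auto simp: C_def P_def)
    ultimately show ?thesis
      using closedF by (auto intro!: closed_Int closed_INT)
  qed
  have D: "D = \<Omega> \<inter> (\<Inter>k. \<Union>m. C k m)"
  proof (intro Set.set_eqI iffI)
    fix x assume x: "x \<in> D"
    then have "x \<in> \<Omega>" by (simp add: D_def)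
    have "\<exists>m. x \<in> C k m" for k
    proof -
      obtain m1 where m1: "P k m1 (Q x)"
        using x D_iff by blast
      obtain e where e: "e > 0" "ball x e \<subseteq> \<Omega>" using \<open>x \<in> \<Omega>\<close> \<Omega> openE by blast
      obtain m2 where m2: "1 / real (Suc m2) < e" using nat_approx_posE[OF e(1)] by blast
      \<comment> \<open>Both conditions persist when the index grows, so the maximum meets the
        Cauchy threshold and the distance to the complement at once.\<close>
      have le: "1 / real (Suc (max m1 m2)) \<le> 1 / Suc m1" "1 / real (Suc (max m1 m2)) \<le> 1 / Suc m2"
        by (auto simp: field_simps)
      have "x \<in> F (max m1 m2)"
        unfolding F_def
      proof (intro CollectI allI impI)
        fix z assume "z \<notin> \<Omega>"
        then have "e \<le> dist x z" using e(2) by (meson mem_ball not_le subset_iff)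
        then show "1 / real (Suc (max m1 m2)) \<le> dist x z" using m2 le(2) by linarith
      qed
      then have "x \<in> C k (max m1 m2)"
        using m1 less_le_trans[OF _ le(1)] unfolding C_def P_def mem_Collect_eq by simp
      then show ?thesis by blast
    qed
    with \<open>x \<in> \<Omega>\<close> show "x \<in> \<Omega> \<inter> (\<Inter>k. \<Union>m. C k m)" by blast
  next
    fix x assume "x \<in> \<Omega> \<inter> (\<Inter>k. \<Union>m. C k m)"
    then show "x \<in> D" unfolding D_iff C_def by blast
  qed
  have [measurable]: "\<Omega> - D \<in> sets borel"
    unfolding D using closedC \<Omega> by (intro sets.Diff sets.Int sets.countable_INT'' sets.countable_UN'') auto
  \<comment> \<open>The quotient \<open>Q\<close> at \<open>x + t *\<^sub>R b\<close> is the
    difference quotient of the slice at \<open>t\<close>, so slices of \<open>\<Omega> - D\<close>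
    are sets of non-differentiability of functions of one variable.\<close>
  have diff_iff: "(\<lambda>s. u (x + s *\<^sub>R b)) differentiable at t \<longleftrightarrow> (\<exists>D. (Q (x + t *\<^sub>R b) \<longlongrightarrow> D) (at 0))" for x t
    by (simp add: real_differentiable_def DERIV_def Q_def[abs_def] scaleR_add_left add.assoc)
  have "\<Omega> - D \<in> null_sets lborel"
  proof (rule null_set_if_slices_null)
    fix x :: 'a
    have "open ((\<lambda>t. x + t *\<^sub>R b) -` \<Omega>)"
      using \<Omega> by (intro open_vimage continuous_intros)
    then have "open {t. x + t *\<^sub>R b \<in> \<Omega>}" by (simp add: vimage_def)
    then have "negligible {t \<in> {t. x + t *\<^sub>R b \<in> \<Omega>}. \<not> (\<lambda>t. u (x + t *\<^sub>R b)) differentiable at t}"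
      using Lip_loc_slice[OF u b] by (rule locally_lipschitz_differentiable_AE)
    then show "negligible {t. x + t *\<^sub>R b \<in> \<Omega> - D}"
      by (rule negligible_subset) (auto simp: D_def diff_iff)
  qed measurable
  then have "\<Omega> - D \<in> null_sets lebesgue" by (rule null_sets_completionI)
  then have "AE x in lebesgue. x \<notin> \<Omega> - D" by (rule AE_not_in)
  then have "AE x in lebesgue_on \<Omega>. x \<in> D"
    using \<Omega> by (subst AE_restrict_space_iff) (auto elim: eventually_mono)
  then show ?thesis
    by (rule eventually_mono) (use diff_iff[of _ 0] in \<open>auto simp: D_def\<close>)
qed

subsection \<open>Minkowski functionals of convex symmetric sets of functions\<close>

text \<open>Instantiated twice, with the unit balls of the modular and of the relaxed modular.
  Convexity and symmetry yield a seminorm; definiteness is a separate matter.\<close>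

locale unit_ball =
  fixes B :: "('a \<Rightarrow> real) set"
  assumes zero_mem: "(\<lambda>x. 0) \<in> B"
    and convex_mem: "\<lbrakk>u \<in> B; v \<in> B; 0 \<le> a; 0 \<le> b; a + b = 1\<rbrakk> \<Longrightarrow> (\<lambda>x. a * u x + b * v x) \<in> B"
    and minus_mem: "u \<in> B \<Longrightarrow> (\<lambda>x. - u x) \<in> B"
begin

text \<open>Convexity and symmetry make the union of the positive multiples of \<open>B\<close> its
  linear span.\<close>

definition linhull :: "('a \<Rightarrow> real) set" where
  "linhull = {u. \<exists>l>0. (\<lambda>x. u x / l) \<in> B}"

definition gauge :: "('a \<Rightarrow> real) \<Rightarrow> real" where
  "gauge u = Inf {l. l > 0 \<and> (\<lambda>x. u x / l) \<in> B}"

lemma shrink_mem: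
  assumes "u \<in> B" "\<bar>c\<bar> \<le> 1"
  shows "(\<lambda>x. c * u x) \<in> B"
proof -
  have pos: "(\<lambda>x. c * u x) \<in> B" if "u \<in> B" "0 \<le> c" "c \<le> 1" for u c
    using convex_mem[OF that(1) zero_mem, of c "1 - c"] that by simp
  show ?thesis
  proof (cases "c \<ge> 0")
    case True
    then show ?thesis using pos assms by simp
  next
    case False
    then show ?thesis using pos[OF minus_mem[OF assms(1)], of "- c"] assms by simp
  qed
qed

lemma divide_mem_mono:
  assumes "(\<lambda>x. u x / l) \<in> B" "0 < l" "l \<le> m"
  shows "(\<lambda>x. u x / m) \<in> B"
  using shrink_mem[OF assms(1), of "l / m"] assms(2,3) by simp

lemma gauge_nonneg:
  assumes "u \<in> linhull"
  shows "0 \<le> gauge u"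
  unfolding gauge_def using assms by (intro cInf_greatest) (auto simp: linhull_def)

lemma gauge_le:
  assumes "0 < l" "(\<lambda>x. u x / l) \<in> B"
  shows "gauge u \<le> l"
  unfolding gauge_def using assms by (intro cInf_lower) (auto intro!: bdd_belowI[of _ 0])

text \<open>The inequality is strict because the infimum need not be attained; this is why the
  seminorm laws below are proved up to an arbitrary \<open>e\<close>.\<close>

lemma gauge_less_imp_mem:
  assumes "u \<in> linhull" "gauge u < l"
  shows "(\<lambda>x. u x / l) \<in> B"
proof -
  have "{l. l > 0 \<and> (\<lambda>x. u x / l) \<in> B} \<noteq> {}"
    using assms(1) by (auto simp: linhull_def)
  then obtain m where "0 < m" "(\<lambda>x. u x / m) \<in> B" "m < l"
    using cInf_lessD[OF _ assms(2)[unfolded gauge_def]] by auto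
  then show ?thesis by (auto intro: divide_mem_mono)
qed

text \<open>The quotient is the convex combination of \<open>u / l\<close> and \<open>v / m\<close>
  with weights \<open>l / (l + m)\<close> and \<open>m / (l + m)\<close>. This is the core of the
  triangle inequality.\<close>

lemma divide_sum_mem:
  assumes "0 < l" "(\<lambda>x. u x / l) \<in> B" "0 < m" "(\<lambda>x. v x / m) \<in> B"
  shows "(\<lambda>x. (u x + v x) / (l + m)) \<in> B"
proof -
  have "(\<lambda>x. l / (l + m) * (u x / l) + m / (l + m) * (v x / m)) \<in> B"
  proof (intro convex_mem assms)
    show "l / (l + m) + m / (l + m) = 1"
      unfolding add_divide_distrib[symmetric] using assms(1,3) by simp
  qed (use assms(1,3) in auto)
  moreover have "l / (l + m) * (u x / l) + m / (l + m) * (v x / m) = (u x + v x) / (l + m)" for x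
    using assms(1,3) by (simp add: add_divide_distrib[of "u x"])
  ultimately show ?thesis by simp
qed

lemma linhull_add:
  assumes "u \<in> linhull" "v \<in> linhull"
  shows "(\<lambda>x. u x + v x) \<in> linhull"
proof -
  obtain l m where "0 < l" "(\<lambda>x. u x / l) \<in> B" "0 < m" "(\<lambda>x. v x / m) \<in> B"
    using assms by (auto simp: linhull_def)
  then have "0 < l + m" "(\<lambda>x. (u x + v x) / (l + m)) \<in> B"
    by (auto intro: divide_sum_mem)
  then show ?thesis unfolding linhull_def mem_Collect_eq by (intro exI conjI)
qed

lemma linhull_zero: "(\<lambda>x. 0) \<in> linhull"
  using zero_mem unfolding linhull_def by (intro CollectI exI[of _ 1]) simp

lemma gauge_zero: "gauge (\<lambda>x. 0) = 0"
proof (rule antisym)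
  show "gauge (\<lambda>x. 0) \<le> 0"
  proof (rule field_le_epsilon)
    show "gauge (\<lambda>x. 0) \<le> 0 + e" if "e > 0" for e
      using that zero_mem by (intro gauge_le) simp_all
  qed
qed (rule gauge_nonneg[OF linhull_zero])

lemma scale_mem_iff:
  assumes "c \<noteq> 0"
  shows "(\<lambda>x. c * u x / (\<bar>c\<bar> * l)) \<in> B \<longleftrightarrow> (\<lambda>x. u x / l) \<in> B"
proof -
  have "(\<lambda>x. - (u x / l)) \<in> B \<longleftrightarrow> (\<lambda>x. u x / l) \<in> B" for u
    using minus_mem[of "\<lambda>x. u x / l"] minus_mem[of "\<lambda>x. - (u x / l)"] by (auto simp only: minus_minus)
  moreover have "c * u x / (\<bar>c\<bar> * l) = (if c > 0 then u x / l else - (u x / l))" for x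
    using assms by (simp add: abs_if)
  ultimately show ?thesis by (cases "c > 0") simp_all
qed

lemma linhull_scale:
  assumes "u \<in> linhull"
  shows "(\<lambda>x. c * u x) \<in> linhull"
proof (cases "c = 0")
  case False
  obtain l where "l > 0" "(\<lambda>x. u x / l) \<in> B"
    using assms by (auto simp: linhull_def)
  with False have "\<bar>c\<bar> * l > 0" "(\<lambda>x. c * u x / (\<bar>c\<bar> * l)) \<in> B"
    by (simp_all add: scale_mem_iff del: times_divide_eq_left times_divide_eq_right)
  then show ?thesis unfolding linhull_def mem_Collect_eq by (intro exI conjI)
qed (simp add: linhull_zero)

lemma linhull_minus: "u \<in> linhull \<Longrightarrow> (\<lambda>x. - u x) \<in> linhull"
  using linhull_scale[of u "-1"] by simp

lemma linhull_diff: "\<lbrakk>u \<in> linhull; v \<in> linhull\<rbrakk> \<Longrightarrow> (\<lambda>x. u x - v x) \<in> linhull"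
  using linhull_add[OF _ linhull_minus] by force

lemma gauge_triangle:
  assumes "u \<in> linhull" "v \<in> linhull"
  shows "gauge (\<lambda>x. u x + v x) \<le> gauge u + gauge v"
proof (rule field_le_epsilon)
  fix e :: real assume "e > 0"
  define l m where "l = gauge u + e / 2" and "m = gauge v + e / 2"
  have "0 < l" "0 < m"
    using \<open>e > 0\<close> assms[THEN gauge_nonneg] by (auto simp: l_def m_def)
  moreover have "(\<lambda>x. u x / l) \<in> B" "(\<lambda>x. v x / m) \<in> B"
    using \<open>e > 0\<close> assms by (auto intro!: gauge_less_imp_mem simp: l_def m_def)
  ultimately have "gauge (\<lambda>x. u x + v x) \<le> l + m"
    by (intro gauge_le divide_sum_mem) auto
  then show "gauge (\<lambda>x. u x + v x) \<le> gauge u + gauge v + e"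
    by (simp add: l_def m_def)
qed

lemma gauge_scale:
  assumes "u \<in> linhull"
  shows "gauge (\<lambda>x. c * u x) = \<bar>c\<bar> * gauge u"
proof (cases "c = 0")
  case False
  have le: "gauge (\<lambda>x. c * u x) \<le> \<bar>c\<bar> * gauge u" if "u \<in> linhull" "c \<noteq> 0" for u c
  proof (rule field_le_epsilon)
    fix e :: real assume "e > 0"
    define l where "l = gauge u + e / \<bar>c\<bar>"
    have "gauge u < l" using \<open>e > 0\<close> that by (simp add: l_def)
    then have "(\<lambda>x. u x / l) \<in> B" "l > 0"
      using that gauge_less_imp_mem gauge_nonneg[of u] by auto
    then have "gauge (\<lambda>x. c * u x) \<le> \<bar>c\<bar> * l"
      using that by (intro gauge_le) (auto simp: scale_mem_iff)
    also have "\<dots> = \<bar>c\<bar> * gauge u + e" using that by (simp add: l_def distrib_left)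
    finally show "gauge (\<lambda>x. c * u x) \<le> \<bar>c\<bar> * gauge u + e" .
  qed
  \<comment> \<open>The reverse inequality is the bound \<open>le\<close> for the scalar
    \<open>1 / c\<close> and the function \<open>c * u\<close>.\<close>
  have "gauge u \<le> \<bar>1 / c\<bar> * gauge (\<lambda>x. c * u x)"
    using le[OF linhull_scale[OF assms], of "1 / c" c] False by simp
  then have "\<bar>c\<bar> * gauge u \<le> gauge (\<lambda>x. c * u x)"
    using False by (simp add: field_simps)
  with le[OF assms False] show ?thesis by simp
qed (simp add: gauge_zero)

lemma gauge_minus_commute:
  assumes "u \<in> linhull" "v \<in> linhull"
  shows "gauge (\<lambda>x. u x - v x) = gauge (\<lambda>x. v x - u x)"
  using gauge_scale[OF linhull_diff[OF assms], of "-1"] by simp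

lemma gauge_diff_triangle:
  assumes "u \<in> linhull" "v \<in> linhull" "w \<in> linhull"
  shows "gauge (\<lambda>x. u x - w x) \<le> gauge (\<lambda>x. u x - v x) + gauge (\<lambda>x. v x - w x)"
  using gauge_triangle[OF linhull_diff[OF assms(1,2)] linhull_diff[OF assms(2,3)]] by simp

end

subsection \<open>Modulars of variable exponent\<close>

lemma powr_convex_combination:
  fixes s t p a b :: real
  assumes p: "1 \<le> p" and st: "0 \<le> s" "0 \<le> t" and ab: "0 \<le> a" "0 \<le> b" "a + b = 1"
  shows "(a * s + b * t) powr p \<le> a * s powr p + b * t powr p"
proof -
  \<comment> \<open>When one argument vanishes, only this inequality remains to be shown; it holds
    because \<open>c powr p \<le> c\<close> on \<open>[0, 1]\<close>.\<close>
  have one: "(c * r) powr p \<le> c * r powr p" if "0 \<le> c" "c \<le> 1" "0 \<le> r" for c r :: real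
    using powr_mono'[of 1 p c] p that by (auto simp: powr_mult intro!: mult_right_mono)
  consider "s = 0" | "t = 0" | "s > 0" "t > 0" using st by linarith
  then show ?thesis
  proof cases
    case 3
    have "((1 - b) *\<^sub>R s + b *\<^sub>R t) powr p \<le> (1 - b) * s powr p + b * t powr p"
      using 3 ab p by (intro convex_onD[OF powr_convex]) auto
    moreover have "a = 1 - b" using ab by simp
    ultimately show ?thesis by simp
  qed (use one[of b t] one[of a s] ab st in auto)
qed

lemma norm_powr_convex:
  fixes y z :: "'b::real_normed_vector"
  assumes p: "1 \<le> p" and ab: "0 \<le> a" "0 \<le> b" "a + b = 1"
  shows "norm (a *\<^sub>R y + b *\<^sub>R z) powr p \<le> a * norm y powr p + b * norm z powr p"
proof -
  have "norm (a *\<^sub>R y + b *\<^sub>R z) \<le> a * norm y + b * norm z"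
    using norm_triangle_ineq[of "a *\<^sub>R y" "b *\<^sub>R z"] ab by simp
  then have "norm (a *\<^sub>R y + b *\<^sub>R z) powr p \<le> (a * norm y + b * norm z) powr p"
    using p by (intro powr_mono2) auto
  also have "\<dots> \<le> a * norm y powr p + b * norm z powr p"
    using assms by (intro powr_convex_combination) auto
  finally show ?thesis .
qed

lemma convergent_if_summable_diff:
  fixes a :: "nat \<Rightarrow> 'b::real_normed_vector"
  assumes "summable (\<lambda>k. a (Suc k) - a k)"
  shows "convergent a"
proof -
  have "(\<lambda>n. a n - a 0) \<longlonglongrightarrow> (\<Sum>k. a (Suc k) - a k)"
    using summable_LIMSEQ[OF assms] by (simp add: sum_lessThan_telescope)
  then have "(\<lambda>n. a n - a 0 + a 0) \<longlonglongrightarrow> (\<Sum>k. a (Suc k) - a k) + a 0"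
    by (intro tendsto_intros)
  then show ?thesis by (auto simp: convergent_def)
qed

section \<open>Variable exponent modular and Luxemburg norm over an arbitrary measure\<close>

locale variable_exponent =
  fixes M :: "'a measure" and p :: "'a \<Rightarrow> real"
  assumes p_measurable [measurable]: "p \<in> borel_measurable M"
    and p_ge_1: "x \<in> space M \<Longrightarrow> 1 \<le> p x"
begin

definition pmod :: "('a \<Rightarrow> 'b::real_normed_vector) \<Rightarrow> ennreal" where
  "pmod w = (\<integral>\<^sup>+x. ennreal (norm (w x) powr p x) \<partial>M)"

lemma pmod_cong_AE: "AE x in M. v x = w x \<Longrightarrow> pmod v = pmod w"
  unfolding pmod_def by (intro nn_integral_cong_AE) auto

lemma pmod_zero [simp]: "pmod (\<lambda>x. 0) = 0"
  by (simp add: pmod_def)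

lemma pmod_convex:
  fixes v w :: "'a \<Rightarrow> 'b::{real_normed_vector, second_countable_topology}"
  assumes [measurable]: "v \<in> borel_measurable M" "w \<in> borel_measurable M"
    and ab: "0 \<le> a" "0 \<le> b" "a + b = 1"
  shows "pmod (\<lambda>x. a *\<^sub>R v x + b *\<^sub>R w x) \<le> ennreal a * pmod v + ennreal b * pmod w"
proof -
  have "pmod (\<lambda>x. a *\<^sub>R v x + b *\<^sub>R w x) \<le>
      (\<integral>\<^sup>+x. ennreal a * ennreal (norm (v x) powr p x) + ennreal b * ennreal (norm (w x) powr p x) \<partial>M)"
    unfolding pmod_def
  proof (intro nn_integral_mono)
    fix x assume "x \<in> space M"
    then show "ennreal (norm (a *\<^sub>R v x + b *\<^sub>R w x) powr p x) \<le>
        ennreal a * ennreal (norm (v x) powr p x) + ennreal b * ennreal (norm (w x) powr p x)"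
      using norm_powr_convex[OF p_ge_1, of x a b "v x" "w x"] ab
      by (simp add: ennreal_leI flip: ennreal_mult ennreal_plus)
  qed
  also have "\<dots> = ennreal a * pmod v + ennreal b * pmod w"
    by (simp add: nn_integral_add nn_integral_cmult pmod_def)
  finally show ?thesis .
qed

lemma pmod_shrink:
  fixes w :: "'a \<Rightarrow> 'b::{real_normed_vector, second_countable_topology}"
  assumes "w \<in> borel_measurable M" "0 \<le> c" "c \<le> 1"
  shows "pmod (\<lambda>x. c *\<^sub>R w x) \<le> ennreal c * pmod w"
  using pmod_convex[of w "\<lambda>x. 0" c "1 - c"] assms by simp

text \<open>Enlarging is where a bound on the exponent matters: for \<open>c \<ge> 1\<close> the
  factor \<open>c powr p x\<close> is at most \<open>c powr P\<close>. Convexity only handles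
  factors up to 1.\<close>

lemma pmod_stretch:
  fixes w :: "'a \<Rightarrow> 'b::{real_normed_vector, second_countable_topology}"
  assumes [measurable]: "w \<in> borel_measurable M" and c: "1 \<le> c" and P: "AE x in M. p x \<le> P"
  shows "pmod (\<lambda>x. c *\<^sub>R w x) \<le> ennreal (c powr P) * pmod w"
proof -
  have "pmod (\<lambda>x. c *\<^sub>R w x) \<le> (\<integral>\<^sup>+x. ennreal (c powr P) * ennreal (norm (w x) powr p x) \<partial>M)"
    unfolding pmod_def
  proof (intro nn_integral_mono_AE, use P in eventually_elim)
    case (elim x)
    then have "c powr p x \<le> c powr P" using c by (intro powr_mono) auto
    then show ?case
      using c by (simp add: powr_mult mult_right_mono ennreal_leI flip: ennreal_mult)
  qed
  also have "\<dots> = ennreal (c powr P) * pmod w"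
    by (simp add: nn_integral_cmult pmod_def)
  finally show ?thesis .
qed

definition Lball :: "('a \<Rightarrow> real) set" where
  "Lball = {u \<in> borel_measurable M. pmod u \<le> 1}"

sublocale L: unit_ball Lball
proof
  fix u v :: "'a \<Rightarrow> real" and a b :: real
  assume uv: "u \<in> Lball" "v \<in> Lball" and ab: "0 \<le> a" "0 \<le> b" "a + b = 1"
  have "pmod (\<lambda>x. a * u x + b * v x) \<le> ennreal a * pmod u + ennreal b * pmod v"
    using pmod_convex[of u v a b] uv ab by (simp add: Lball_def)
  also have "\<dots> \<le> ennreal a * 1 + ennreal b * 1"
    using uv by (intro add_mono mult_left_mono) (auto simp: Lball_def)
  also have "\<dots> = 1" using ab by (simp flip: ennreal_plus)
  finally show "(\<lambda>x. a * u x + b * v x) \<in> Lball"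
    using uv by (auto simp: Lball_def intro!: borel_measurable_add borel_measurable_times)
qed (auto simp: Lball_def pmod_def)

lemma Lhull_measurable [measurable_dest]:
  assumes "u \<in> L.linhull"
  shows "u \<in> borel_measurable M"
proof -
  obtain l where l: "l > 0" "(\<lambda>x. u x / l) \<in> borel_measurable M"
    using assms unfolding L.linhull_def by (auto simp: Lball_def)
  have "(\<lambda>x. l * (u x / l)) \<in> borel_measurable M" using l(2) by measurable
  with l(1) show ?thesis by simp
qed

text \<open>The unit ball asks for a modular of at most 1, the Lebesgue space only for a finite one.
  By convexity, dividing further by \<open>max c 1\<close> brings a finite value \<open>c\<close>
  down to at most 1.\<close>

lemma Lhull_iff: "u \<in> L.linhull \<longleftrightarrow> u \<in> borel_measurable M \<and> (\<exists>l>0. pmod (\<lambda>x. u x / l) < \<infinity>)"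
proof safe
  assume u: "u \<in> L.linhull"
  then show "u \<in> borel_measurable M" by (rule Lhull_measurable)
  from u obtain l where l: "l > 0" "pmod (\<lambda>x. u x / l) \<le> 1"
    unfolding L.linhull_def by (auto simp: Lball_def)
  have "(1::ennreal) < \<infinity>" by simp
  with l show "\<exists>l>0. pmod (\<lambda>x. u x / l) < \<infinity>" by (blast intro: le_less_trans)
next
  fix l assume [measurable]: "u \<in> borel_measurable M" and l: "0 < l" "pmod (\<lambda>x. u x / l) < \<infinity>"
  obtain c where c: "pmod (\<lambda>x. u x / l) = ennreal c" "c \<ge> 0"
    using l(2) by (cases "pmod (\<lambda>x. u x / l)") auto
  define m where "m = max c 1"
  have m: "c \<le> m" "1 \<le> m" by (auto simp: m_def)
  have "pmod (\<lambda>x. (1 / m) *\<^sub>R (u x / l)) \<le> ennreal (1 / m) * pmod (\<lambda>x. u x / l)"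
    using m by (intro pmod_shrink) auto
  also have "\<dots> \<le> 1"
    using m c by (simp flip: ennreal_mult ennreal_1)
  finally have "(\<lambda>x. u x / (m * l)) \<in> Lball"
    by (simp add: Lball_def)
  then show "u \<in> L.linhull"
    unfolding L.linhull_def using m l by (intro CollectI exI[of _ "m * l"]) auto
qed

text \<open>If the gauge vanishes, \<open>u / l\<close> has modular at most 1 for every small
  \<open>l\<close>, and convexity gives \<open>u\<close> a modular of at most
  \<open>l\<close>.\<close>

lemma Lgauge_eq_0_iff:
  assumes u: "u \<in> L.linhull"
  shows "L.gauge u = 0 \<longleftrightarrow> (AE x in M. u x = 0)"
proof
  assume 0: "L.gauge u = 0"
  note [measurable] = Lhull_measurable[OF u]
  have "pmod u \<le> 0"
  proof (rule ennreal_le_epsilon)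
    fix e :: real assume "e > 0"
    \<comment> \<open>\<open>pmod_shrink\<close> admits only factors up to 1.\<close>
    define l where "l = min e 1"
    have l: "0 < l" "l \<le> e" "l \<le> 1" using \<open>e > 0\<close> by (auto simp: l_def)
    have "(\<lambda>x. u x / l) \<in> Lball"
      using u 0 l by (intro L.gauge_less_imp_mem) auto
    then have le: "pmod (\<lambda>x. u x / l) \<le> 1" by (simp add: Lball_def)
    have "pmod (\<lambda>x. l *\<^sub>R (u x / l)) \<le> ennreal l * pmod (\<lambda>x. u x / l)"
      using l by (intro pmod_shrink) auto
    also have "\<dots> \<le> ennreal l * 1" using le by (rule mult_left_mono) simp
    also have "\<dots> \<le> 0 + ennreal e" using l by (simp add: ennreal_leI)
    finally show "pmod u \<le> 0 + ennreal e" using l by simp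
  qed
  then have "AE x in M. ennreal (\<bar>u x\<bar> powr p x) = 0"
    by (simp add: pmod_def nn_integral_0_iff_AE)
  then show "AE x in M. u x = 0" by eventually_elim auto
next
  assume ae: "AE x in M. u x = 0"
  have "(\<lambda>x. u x / l) \<in> Lball" for l
  proof -
    have "pmod (\<lambda>x. u x / l) = pmod (\<lambda>x. 0::real)"
      using ae by (intro pmod_cong_AE) auto
    then show ?thesis using Lhull_measurable[OF u] by (simp add: Lball_def)
  qed
  then have "L.gauge u \<le> 0 + e" if "e > 0" for e
    using that by (auto intro: L.gauge_le)
  then have "L.gauge u \<le> 0" by (rule field_le_epsilon)
  with L.gauge_nonneg[OF u] show "L.gauge u = 0" by simp
qed

text \<open>Convexity turns \<open>\<rho>(4\<^sup>k d\<^sub>k) \<le> 1\<close> into \<open>\<rho>(2\<^sup>k d\<^sub>k) \<le> 2\<^sup>-\<^sup>k\<close>, which is summable, so almost everywhere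
  \<open>\<bar>d\<^sub>k\<bar> \<le> 2\<^sup>-\<^sup>k\<close> eventually.\<close>

lemma Lhull_fast_Cauchy_AE_convergent:
  assumes s: "\<And>i. s i \<in> L.linhull"
    and r: "\<And>k. L.gauge (\<lambda>x. s (r (Suc k)) x - s (r k) x) < (1 / 4) ^ k"
  shows "AE x in M. convergent (\<lambda>k. s (r k) x)"
proof -
  note [measurable] = Lhull_measurable[OF s]
  define d where "d k x = s (r (Suc k)) x - s (r k) x" for k x
  have [measurable]: "d k \<in> borel_measurable M" for k unfolding d_def[abs_def] by measurable
  have "pmod (\<lambda>x. 2 ^ k * d k x) \<le> ennreal ((1 / 2) ^ k)" for k
  proof -
    have "(\<lambda>x. d k x / (1 / 4) ^ k) \<in> Lball"
      unfolding d_def by (intro L.gauge_less_imp_mem L.linhull_diff s r)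
    then have le: "pmod (\<lambda>x. d k x / (1 / 4) ^ k) \<le> 1" by (simp add: Lball_def)
    have "(2::real) ^ k = (1 / 2) ^ k * 4 ^ k"
      by (simp flip: power_mult_distrib)
    then have "pmod (\<lambda>x. 2 ^ k * d k x) = pmod (\<lambda>x. (1 / 2) ^ k *\<^sub>R (d k x / (1 / 4) ^ k))"
      by (simp add: power_divide mult_ac)
    also have "\<dots> \<le> ennreal ((1 / 2) ^ k) * pmod (\<lambda>x. d k x / (1 / 4) ^ k)"
      by (intro pmod_shrink) (auto simp: power_le_one)
    also have "\<dots> \<le> ennreal ((1 / 2) ^ k) * 1" using le by (rule mult_left_mono) simp
    finally show ?thesis by simp
  qed
  then have "(\<Sum>k. pmod (\<lambda>x. 2 ^ k * d k x)) \<le> (\<Sum>k. ennreal ((1 / 2) ^ k))"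
    by (intro suminf_le) auto
  also have "\<dots> = ennreal (\<Sum>k. (1 / 2) ^ k)"
    by (intro suminf_ennreal2) (auto intro!: summable_geometric)
  also have "\<dots> < \<infinity>" by simp
  finally have "(\<integral>\<^sup>+x. (\<Sum>k. ennreal (\<bar>2 ^ k * d k x\<bar> powr p x)) \<partial>M) < \<infinity>"
    by (simp add: pmod_def nn_integral_suminf)
  then have "AE x in M. (\<Sum>k. ennreal (\<bar>2 ^ k * d k x\<bar> powr p x)) \<noteq> \<infinity>"
    by (intro nn_integral_noteq_infinite) auto
  then show ?thesis
  proof (rule AE_mp, intro AE_I2 impI)
    fix x assume x: "x \<in> space M" and "(\<Sum>k. ennreal (\<bar>2 ^ k * d k x\<bar> powr p x)) \<noteq> \<infinity>"
    then have "summable (\<lambda>k. \<bar>2 ^ k * d k x\<bar> powr p x)"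
      by (intro summable_suminf_not_top) auto
    then have "(\<lambda>k. \<bar>2 ^ k * d k x\<bar> powr p x) \<longlonglongrightarrow> 0" by (rule summable_LIMSEQ_zero)
    then have "\<forall>\<^sub>F k in sequentially. \<bar>2 ^ k * d k x\<bar> powr p x < 1"
      by (rule order_tendstoD) simp
    then have "\<forall>\<^sub>F k in sequentially. norm (d k x) \<le> (1 / 2) ^ k"
    proof eventually_elim
      case (elim k)
      have "\<bar>2 ^ k * d k x\<bar> < 1"
        using elim p_ge_1[OF x] ge_one_powr_ge_zero[of "\<bar>2 ^ k * d k x\<bar>" "p x"] by force
      then show ?case by (simp add: abs_mult field_simps power_one_over)
    qed
    then have "summable (\<lambda>k. d k x)"
      by (rule summable_comparison_test_ev) (auto intro!: summable_geometric)
    then show "convergent (\<lambda>k. s (r k) x)"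
      unfolding d_def by (rule convergent_if_summable_diff)
  qed
qed

text \<open>The Riesz-Fischer argument: a rapidly Cauchy subsequence converges almost everywhere,
  and Fatou's lemma carries the modular bound for \<open>(s i - s (r k)) / e\<close> over to
  \<open>(s i - u) / e\<close>.\<close>

lemma Lhull_complete:
  assumes s: "\<And>i. s i \<in> L.linhull"
    and Cauchy: "\<And>e. e > 0 \<Longrightarrow> \<exists>N. \<forall>i\<ge>N. \<forall>j\<ge>N. L.gauge (\<lambda>x. s i x - s j x) < e"
  shows "\<exists>u\<in>L.linhull. (\<lambda>i. L.gauge (\<lambda>x. s i x - u x)) \<longlonglongrightarrow> 0"
proof -
  note [measurable] = Lhull_measurable[OF s]
  have "\<forall>k. \<exists>N. \<forall>i\<ge>N. \<forall>j\<ge>N. L.gauge (\<lambda>x. s i x - s j x) < (1 / 4) ^ k"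
    by (intro allI Cauchy) simp
  then obtain N where N: "\<And>k i j. \<lbrakk>i \<ge> N k; j \<ge> N k\<rbrakk> \<Longrightarrow> L.gauge (\<lambda>x. s i x - s j x) < (1 / 4) ^ k"
    by metis
  \<comment> \<open>Adding up the thresholds makes \<open>r k\<close> exceed \<open>k\<close> and
    all \<open>N i\<close> with \<open>i \<le> k\<close>, so \<open>r k\<close> and
    \<open>r (Suc k)\<close> are both beyond \<open>N k\<close>.\<close>
  define r where "r k = k + (\<Sum>i\<le>k. N i)" for k
  have r: "k \<le> r k" "N k \<le> r k" "N k \<le> r (Suc k)" for k
  proof -
    have "N k \<le> (\<Sum>i\<le>k. N i)" by (rule member_le_sum) auto
    then show "k \<le> r k" "N k \<le> r k" "N k \<le> r (Suc k)" by (auto simp: r_def)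
  qed
  have ae: "AE x in M. convergent (\<lambda>k. s (r k) x)"
    using s r(2,3) by (intro Lhull_fast_Cauchy_AE_convergent N)
  \<comment> \<open>The total operator \<open>lim\<close> gives a measurable function, with an
    irrelevant value where the subsequence diverges.\<close>
  define u where "u x = lim (\<lambda>k. s (r k) x)" for x
  have [measurable]: "u \<in> borel_measurable M" unfolding u_def[abs_def] by measurable
  have lim: "AE x in M. (\<lambda>k. s (r k) x) \<longlonglongrightarrow> u x"
    using ae by eventually_elim (simp add: convergent_LIMSEQ_iff u_def)
  have main: "\<exists>N. \<forall>i\<ge>N. (\<lambda>x. (s i x - u x) / e) \<in> Lball" if e: "e > 0" for e
  proof -
    obtain N where N: "\<And>i j. \<lbrakk>i \<ge> N; j \<ge> N\<rbrakk> \<Longrightarrow> L.gauge (\<lambda>x. s i x - s j x) < e"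
      using Cauchy[OF e] by blast
    show ?thesis
    proof (intro exI[of _ N] allI impI)
      fix i assume i: "N \<le> i"
      have "pmod (\<lambda>x. (s i x - u x) / e) \<le> (\<integral>\<^sup>+x. liminf (\<lambda>k. ennreal (\<bar>(s i x - s (r k) x) / e\<bar> powr p x)) \<partial>M)"
        unfolding pmod_def
      proof (rule nn_integral_mono_AE, use lim in \<open>rule AE_mp\<close>, intro AE_I2 impI)
        fix x assume x: "x \<in> space M" and "(\<lambda>k. s (r k) x) \<longlonglongrightarrow> u x"
        then have "(\<lambda>k. ennreal (\<bar>(s i x - s (r k) x) / e\<bar> powr p x)) \<longlonglongrightarrow> ennreal (\<bar>(s i x - u x) / e\<bar> powr p x)"
          using p_ge_1[OF x] e by (intro tendsto_intros tendsto_ennrealI tendsto_powr') (auto intro: tendsto_intros)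
        then have "liminf (\<lambda>k. ennreal (\<bar>(s i x - s (r k) x) / e\<bar> powr p x)) = ennreal (\<bar>(s i x - u x) / e\<bar> powr p x)"
          by (rule lim_imp_Liminf[OF sequentially_bot])
        then show "ennreal (norm ((s i x - u x) / e) powr p x) \<le> liminf (\<lambda>k. ennreal (\<bar>(s i x - s (r k) x) / e\<bar> powr p x))"
          by simp
      qed
      also have "\<dots> \<le> liminf (\<lambda>k. \<integral>\<^sup>+x. ennreal (\<bar>(s i x - s (r k) x) / e\<bar> powr p x) \<partial>M)"
        by (intro nn_integral_liminf) measurable
      also have "\<dots> \<le> 1"
      proof (rule Liminf_le)
        have "(\<lambda>x. (s i x - s (r k) x) / e) \<in> Lball" if "k \<ge> N" for k
          using i that r(1)[of k] s by (intro L.gauge_less_imp_mem L.linhull_diff N) auto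
        then show "\<forall>\<^sub>F k in sequentially. (\<integral>\<^sup>+x. ennreal (\<bar>(s i x - s (r k) x) / e\<bar> powr p x) \<partial>M) \<le> 1"
          unfolding Lball_def pmod_def by (intro eventually_sequentiallyI[of N]) auto
      qed simp
      finally show "(\<lambda>x. (s i x - u x) / e) \<in> Lball" by (simp add: Lball_def)
    qed
  qed
  have "u \<in> L.linhull"
  proof -
    obtain N where "(\<lambda>x. (s N x - u x) / 1) \<in> Lball" using main[of 1] by auto
    then have "(\<lambda>x. s N x - u x) \<in> L.linhull" unfolding L.linhull_def by (intro CollectI exI[of _ 1]) simp
    from L.linhull_diff[OF s[of N] this] show ?thesis by simp
  qed
  moreover have "(\<lambda>i. L.gauge (\<lambda>x. s i x - u x)) \<longlonglongrightarrow> 0"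
  proof (rule LIMSEQ_I)
    fix e :: real assume "e > 0"
    \<comment> \<open>Membership in the ball bounds the gauge only weakly; the scale
      \<open>e / 2\<close> leaves room for the strict inequality.\<close>
    then obtain N where N: "\<And>i. i \<ge> N \<Longrightarrow> (\<lambda>x. (s i x - u x) / (e / 2)) \<in> Lball"
      using main[of "e / 2"] by auto
    have "norm (L.gauge (\<lambda>x. s i x - u x) - 0) < e" if "i \<ge> N" for i
      using L.gauge_le[OF _ N[OF that]] L.gauge_nonneg[OF L.linhull_diff[OF s \<open>u \<in> L.linhull\<close>], of i] \<open>e > 0\<close> by auto
    then show "\<exists>N. \<forall>i\<ge>N. norm (L.gauge (\<lambda>x. s i x - u x) - 0) < e" by blast
  qed
  ultimately show ?thesis by blast
qed

end

subsection \<open>Gradients of locally Lipschitz functions and the relaxed modular\<close>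

lemma Lip_loc_linear:
  assumes u: "u \<in> Lip_loc \<Omega>" and v: "v \<in> Lip_loc \<Omega>"
  shows "(\<lambda>x. a * u x + b * v x) \<in> Lip_loc \<Omega>"
  unfolding Lip_loc_def
proof safe
  fix x assume "x \<in> \<Omega>"
  then obtain r L r' L' where r: "r > 0" "r' > 0"
    and L: "L-lipschitz_on (cball x r \<inter> \<Omega>) u" and L': "L'-lipschitz_on (cball x r' \<inter> \<Omega>) v"
    using u v unfolding Lip_loc_def by blast
  have "(\<bar>a\<bar> * L + \<bar>b\<bar> * L')-lipschitz_on (cball x (min r r') \<inter> \<Omega>) (\<lambda>x. a * u x + b * v x)"
    by (intro lipschitz_on_add lipschitz_on_cmult_real lipschitz_on_subset[OF L] lipschitz_on_subset[OF L']) auto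
  with r show "\<exists>r>0. \<exists>L. L-lipschitz_on (cball x r \<inter> \<Omega>) (\<lambda>x. a * u x + b * v x)"
    by (intro exI[of _ "min r r'"]) auto
qed

lemma Lip_loc_partial_derivatives_AE:
  fixes \<Omega> :: "'a::euclidean_space set"
  assumes "open \<Omega>" "u \<in> Lip_loc \<Omega>"
  shows "AE x in lebesgue_on \<Omega>. \<forall>b\<in>Basis. (\<lambda>t. u (x + t *\<^sub>R b)) field_differentiable at 0"
proof -
  have "AE x in lebesgue_on \<Omega>. (\<lambda>t. u (x + t *\<^sub>R b)) differentiable at 0" if "b \<in> Basis" for b
    using Lip_loc_directional_derivative_AE[OF assms] that by simp
  then have "AE x in lebesgue_on \<Omega>. \<forall>b\<in>Basis. (\<lambda>t. u (x + t *\<^sub>R b)) differentiable at 0"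
    by (intro AE_finite_allI) auto
  then show ?thesis
    by eventually_elim (simp add: real_differentiable_def field_differentiable_def)
qed

lemma grad_linear_AE:
  assumes \<Omega>: "open \<Omega>" and uv: "u \<in> Lip_loc \<Omega>" "v \<in> Lip_loc \<Omega>"
  shows "AE x in lebesgue_on \<Omega>. grad (\<lambda>x. a * u x + b * v x) x = a *\<^sub>R grad u x + b *\<^sub>R grad v x"
  using Lip_loc_partial_derivatives_AE[OF \<Omega> uv(1)] Lip_loc_partial_derivatives_AE[OF \<Omega> uv(2)]
proof eventually_elim
  case (elim x)
  have "deriv (\<lambda>t. a * u (x + t *\<^sub>R e) + b * v (x + t *\<^sub>R e)) 0 =
      a * deriv (\<lambda>t. u (x + t *\<^sub>R e)) 0 + b * deriv (\<lambda>t. v (x + t *\<^sub>R e)) 0" if "e \<in> Basis" for e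
    using elim that
    by (intro DERIV_imp_deriv DERIV_add DERIV_cmult) (auto simp: field_differentiable_derivI)
  then show ?case
    unfolding grad_def by (simp add: scaleR_sum_right sum.distrib scaleR_add_left)
qed

text \<open>The convexity and scaling estimates for \<open>pmod\<close> ask for measurable
  arguments, whereas \<open>deriv\<close> is unspecified where a partial derivative fails to exist.
  Limits of difference quotients with step \<open>1 / Suc n\<close> form a Borel
  representative.\<close>

lemma grad_AE_measurable:
  assumes \<Omega>: "open \<Omega>" and u: "u \<in> Lip_loc \<Omega>"
  obtains g where "g \<in> borel_measurable (lebesgue_on \<Omega>)" "AE x in lebesgue_on \<Omega>. grad u x = g x"
proof
  \<comment> \<open>Extension by zero makes the quotients Borel on the whole space. For
    \<open>x\<close> in the open set \<open>\<Omega>\<close> the shifted points eventually lie in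
    \<open>\<Omega>\<close>, where \<open>u0\<close> equals \<open>u\<close>.\<close>
  define u0 where "u0 x = (if x \<in> \<Omega> then u x else 0)" for x
  have "(\<lambda>x. indicator \<Omega> x *\<^sub>R u x) \<in> borel_measurable borel"
    using \<Omega> by (intro borel_measurable_continuous_on_indicator Lip_loc_continuous_on[OF \<Omega> u]) auto
  then have [measurable]: "u0 \<in> borel_measurable borel"
    by (rule measurable_cong[THEN iffD1, rotated]) (auto simp: u0_def)
  define q where "q b n x = (u0 (x + (1 / Suc n) *\<^sub>R b) - u0 x) / (1 / Suc n)" for b and n :: nat and x
  define g where "g x = (\<Sum>b\<in>Basis. lim (\<lambda>n. q b n x) *\<^sub>R b)" for x
  have "g \<in> borel_measurable borel"
    unfolding g_def[abs_def] q_def by measurable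
  then show "g \<in> borel_measurable (lebesgue_on \<Omega>)"
    by (intro measurable_restrict_space1 measurable_completion) simp
  have "AE x in lebesgue_on \<Omega>. x \<in> \<Omega>"
    by (rule AE_I2) (simp add: space_restrict_space)
  then show "AE x in lebesgue_on \<Omega>. grad u x = g x"
    using Lip_loc_partial_derivatives_AE[OF \<Omega> u]
  proof eventually_elim
    case (elim x)
    have "lim (\<lambda>n. q b n x) = deriv (\<lambda>t. u (x + t *\<^sub>R b)) 0" if b: "b \<in> Basis" for b
    proof (rule limI)
      define D where "D = deriv (\<lambda>t. u (x + t *\<^sub>R b)) 0"
      have "((\<lambda>t. u (x + t *\<^sub>R b)) has_field_derivative D) (at 0)"
        using elim b unfolding D_def by (auto simp: field_differentiable_derivI)
      then have "((\<lambda>t. (u (x + t *\<^sub>R b) - u x) / t) \<longlongrightarrow> D) (at 0)"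
        by (simp add: has_field_derivative_iff)
      moreover have "filterlim (\<lambda>n. 1 / real (Suc n)) (at 0) sequentially"
        unfolding filterlim_at using lim_inverse_n'[THEN LIMSEQ_Suc] by auto
      ultimately have lim: "(\<lambda>n. (u (x + (1 / Suc n) *\<^sub>R b) - u x) / (1 / Suc n)) \<longlonglongrightarrow> D"
        by (rule filterlim_compose)
      have "(\<lambda>n. x + (1 / Suc n) *\<^sub>R b) \<longlonglongrightarrow> x + 0 *\<^sub>R b"
        by (intro tendsto_intros lim_inverse_n'[THEN LIMSEQ_Suc])
      then have "\<forall>\<^sub>F n in sequentially. x + (1 / Suc n) *\<^sub>R b \<in> \<Omega>"
        using \<Omega> elim by (intro topological_tendstoD) auto
      then have "\<forall>\<^sub>F n in sequentially. (u (x + (1 / Suc n) *\<^sub>R b) - u x) / (1 / Suc n) = q b n x"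
        by eventually_elim (use elim in \<open>simp add: q_def u0_def\<close>)
      with lim show "(\<lambda>n. q b n x) \<longlonglongrightarrow> D"
        by (rule Lim_transform_eventually)
    qed
    then show ?case by (simp add: grad_def g_def)
  qed
qed

section \<open>Energy of locally Lipschitz functions and the relaxed modular\<close>

locale bounded_variable_exponent =
  fixes \<Omega> :: "'a::euclidean_space set" and p :: "'a \<Rightarrow> real" and P :: real
  assumes open_\<Omega>: "open \<Omega>"
    and p_meas: "p \<in> borel_measurable (lebesgue_on \<Omega>)"
    and p_ge: "x \<in> \<Omega> \<Longrightarrow> 1 \<le> p x"
    and p_le: "AE x in lebesgue_on \<Omega>. p x \<le> P"
begin

sublocale variable_exponent "lebesgue_on \<Omega>" p
  by unfold_locales (auto simp: p_meas p_ge space_restrict_space)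

lemma modular_eq: "modular \<Omega> p u = pmod u"
  by (simp add: modular_def pmod_def)

lemma Lp_var_eq: "Lp_var \<Omega> p = L.linhull"
  by (auto simp: Lp_var_def Lhull_iff modular_eq)

lemma Lp_norm_eq:
  assumes "u \<in> L.linhull"
  shows "Lp_norm \<Omega> p u = L.gauge u"
  unfolding Lp_norm_def L.gauge_def modular_eq using Lhull_measurable[OF assms] by (simp add: Lball_def)

abbreviation energy :: "('a \<Rightarrow> real) \<Rightarrow> ennreal" where
  "energy u \<equiv> pmod (grad u)"

lemma energy_scale:
  assumes "u \<in> Lip_loc \<Omega>"
  shows "energy (\<lambda>x. c * u x) = pmod (\<lambda>x. c *\<^sub>R grad u x)"
  using grad_linear_AE[OF open_\<Omega> assms assms, of c 0] by (intro pmod_cong_AE) simp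

lemma energy_convex:
  assumes u: "u \<in> Lip_loc \<Omega>" and v: "v \<in> Lip_loc \<Omega>" and ab: "0 \<le> a" "0 \<le> b" "a + b = 1"
  shows "energy (\<lambda>x. a * u x + b * v x) \<le> ennreal a * energy u + ennreal b * energy v"
proof -
  obtain g where g: "g \<in> borel_measurable (lebesgue_on \<Omega>)" "AE x in lebesgue_on \<Omega>. grad u x = g x"
    using grad_AE_measurable[OF open_\<Omega> u] .
  obtain h where h: "h \<in> borel_measurable (lebesgue_on \<Omega>)" "AE x in lebesgue_on \<Omega>. grad v x = h x"
    using grad_AE_measurable[OF open_\<Omega> v] .
  have "energy (\<lambda>x. a * u x + b * v x) = pmod (\<lambda>x. a *\<^sub>R g x + b *\<^sub>R h x)"
    using grad_linear_AE[OF open_\<Omega> u v, of a b] g(2) h(2) by (intro pmod_cong_AE, eventually_elim) simp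
  also have "\<dots> \<le> ennreal a * pmod g + ennreal b * pmod h"
    by (rule pmod_convex[OF g(1) h(1) ab])
  also have "pmod g = energy u" using g(2) by (intro pmod_cong_AE) auto
  also have "pmod h = energy v" using h(2) by (intro pmod_cong_AE) auto
  finally show ?thesis .
qed

lemma energy_shrink:
  assumes u: "u \<in> Lip_loc \<Omega>" and c: "0 \<le> c" "c \<le> 1"
  shows "energy (\<lambda>x. c * u x) \<le> ennreal c * energy u"
proof -
  obtain g where g: "g \<in> borel_measurable (lebesgue_on \<Omega>)" "AE x in lebesgue_on \<Omega>. grad u x = g x"
    using grad_AE_measurable[OF open_\<Omega> u] .
  have "energy (\<lambda>x. c * u x) = pmod (\<lambda>x. c *\<^sub>R g x)"
    unfolding energy_scale[OF u] using g(2) by (intro pmod_cong_AE) auto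
  also have "\<dots> \<le> ennreal c * pmod g" by (rule pmod_shrink[OF g(1) c])
  also have "pmod g = energy u" using g(2) by (intro pmod_cong_AE) auto
  finally show ?thesis .
qed

lemma energy_stretch:
  assumes u: "u \<in> Lip_loc \<Omega>" and c: "1 \<le> c"
  shows "energy (\<lambda>x. c * u x) \<le> ennreal (c powr P) * energy u"
proof -
  obtain g where g: "g \<in> borel_measurable (lebesgue_on \<Omega>)" "AE x in lebesgue_on \<Omega>. grad u x = g x"
    using grad_AE_measurable[OF open_\<Omega> u] .
  have "energy (\<lambda>x. c * u x) = pmod (\<lambda>x. c *\<^sub>R g x)"
    unfolding energy_scale[OF u] using g(2) by (intro pmod_cong_AE) auto
  also have "\<dots> \<le> ennreal (c powr P) * pmod g" by (rule pmod_stretch[OF g(1) c p_le])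
  also have "pmod g = energy u" using g(2) by (intro pmod_cong_AE) auto
  finally show ?thesis .
qed

lemma energy_minus:
  assumes "u \<in> Lip_loc \<Omega>"
  shows "energy (\<lambda>x. - u x) = energy u"
  using energy_scale[OF assms, of "-1"] by (simp add: pmod_def)

text \<open>Trades sequences and lower limits for single approximants. Forwards, the energy is small
  infinitely often and the distance eventually, so some index has both. Backwards, approximants for
  \<open>e = 1 / Suc n\<close> form an admissible sequence.\<close>

lemma BV_modular_le_iff:
  assumes u: "u \<in> L.linhull" and c: "c < \<infinity>"
  shows "BV_modular \<Omega> p u \<le> c \<longleftrightarrow>
    (\<forall>e>0. \<exists>w\<in>Lip_loc \<Omega> \<inter> L.linhull. L.gauge (\<lambda>x. w x - u x) < e \<and> energy w \<le> c + ennreal e)"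
    (is "_ \<longleftrightarrow> (\<forall>e>0. ?R e)")
proof safe
  fix e :: real assume le: "BV_modular \<Omega> p u \<le> c" and e: "e > 0"
  \<comment> \<open>Finiteness of \<open>c\<close> makes this strict, as is needed to select a
    sequence below the infimum and an index below the lower limit.\<close>
  have "c < c + ennreal e"
    using c e by (cases c) (auto simp: ennreal_less_iff simp flip: ennreal_plus)
  with le have "BV_modular \<Omega> p u < c + ennreal e" by (rule le_less_trans)
  then obtain us where us: "\<And>i. us i \<in> Lip_loc \<Omega>" "\<And>i. us i \<in> L.linhull"
    and lim: "(\<lambda>i. Lp_norm \<Omega> p (\<lambda>x. us i x - u x)) \<longlonglongrightarrow> 0"
    and less: "liminf (\<lambda>i. energy (us i)) < c + ennreal e"
    unfolding BV_modular_def Inf_less_iff by (auto simp: Lp_var_eq pmod_def)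
  have "\<not> (\<forall>\<^sub>F i in sequentially. c + ennreal e \<le> energy (us i))"
    using Liminf_bounded[of "c + ennreal e" "\<lambda>i. energy (us i)" sequentially] less by auto
  then have "\<exists>\<^sub>F i in sequentially. energy (us i) < c + ennreal e"
    by (simp add: frequently_def not_less)
  moreover have "\<forall>\<^sub>F i in sequentially. Lp_norm \<Omega> p (\<lambda>x. us i x - u x) < e"
    using lim e by (rule order_tendstoD)
  ultimately have "\<exists>\<^sub>F i in sequentially. energy (us i) < c + ennreal e \<and> Lp_norm \<Omega> p (\<lambda>x. us i x - u x) < e"
    by (rule frequently_eventually_frequently)
  then obtain i where "energy (us i) < c + ennreal e" "Lp_norm \<Omega> p (\<lambda>x. us i x - u x) < e"
    by (auto dest: frequently_ex)
  then show "?R e"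
    using us[of i] Lp_norm_eq[OF L.linhull_diff[OF us(2)[of i] u]]
    by (intro bexI[of _ "us i"]) auto
next
  assume R: "\<forall>e>0. ?R e"
  have "\<forall>n. ?R (1 / real (Suc n))"
    using R by simp
  then obtain w where w: "\<And>n. w n \<in> Lip_loc \<Omega>" "\<And>n. w n \<in> L.linhull"
    and less: "\<And>n. L.gauge (\<lambda>x. w n x - u x) < 1 / real (Suc n)"
    and energy: "\<And>n. energy (w n) \<le> c + ennreal (1 / real (Suc n))"
    unfolding Bex_def Int_iff choice_iff by blast
  have lim0: "(\<lambda>n. 1 / real (Suc n)) \<longlonglongrightarrow> 0" by (rule lim_inverse_n'[THEN LIMSEQ_Suc])
  have norm: "Lp_norm \<Omega> p (\<lambda>x. w n x - u x) = L.gauge (\<lambda>x. w n x - u x)" for n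
    by (intro Lp_norm_eq L.linhull_diff w u)
  have "(\<lambda>n. L.gauge (\<lambda>x. w n x - u x)) \<longlonglongrightarrow> 0"
  proof (rule tendsto_sandwich[OF _ _ tendsto_const lim0]; rule always_eventually; rule allI)
    show "0 \<le> L.gauge (\<lambda>x. w n x - u x)" for n by (intro L.gauge_nonneg L.linhull_diff w u)
    show "L.gauge (\<lambda>x. w n x - u x) \<le> 1 / real (Suc n)" for n using less[of n] by (rule less_imp_le)
  qed
  then have "BV_modular \<Omega> p u \<le> liminf (\<lambda>n. energy (w n))"
    unfolding BV_modular_def pmod_def using w norm
    by (intro Inf_lower CollectI exI[of _ w]) (auto simp: Lp_var_eq)
  also have "\<dots> \<le> liminf (\<lambda>n. c + ennreal (1 / real (Suc n)))"
    using energy by (intro Liminf_mono always_eventually) auto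
  also have "(\<lambda>n. c + ennreal (1 / real (Suc n))) \<longlonglongrightarrow> c + ennreal 0"
    by (intro tendsto_add tendsto_const tendsto_ennrealI lim0)
  then have "liminf (\<lambda>n. c + ennreal (1 / real (Suc n))) = c"
    by (intro lim_imp_Liminf) auto
  finally show "BV_modular \<Omega> p u \<le> c" .
qed

lemma BV_modular_approx:
  assumes "u \<in> L.linhull" "c < \<infinity>" "BV_modular \<Omega> p u \<le> c" "e > 0"
  obtains w where "w \<in> Lip_loc \<Omega>" "w \<in> L.linhull" "L.gauge (\<lambda>x. w x - u x) < e" "energy w \<le> c + ennreal e"
  using assms BV_modular_le_iff by blast

text \<open>With single approximants the diagonal argument is one triangle inequality: half of
  \<open>e\<close> is spent on passing from \<open>u\<close> to \<open>v\<close>, half on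
  approximating \<open>v\<close>.\<close>

lemma BV_modular_lsc:
  assumes u: "u \<in> L.linhull" and c: "c < \<infinity>"
    and approx: "\<And>e. e > 0 \<Longrightarrow> \<exists>v\<in>L.linhull. L.gauge (\<lambda>x. v x - u x) < e \<and> BV_modular \<Omega> p v \<le> c"
  shows "BV_modular \<Omega> p u \<le> c"
  unfolding BV_modular_le_iff[OF u c]
proof (intro allI impI)
  fix e :: real assume "e > 0"
  then have e2: "e / 2 > 0" by simp
  then obtain v where v: "v \<in> L.linhull" "L.gauge (\<lambda>x. v x - u x) < e / 2" "BV_modular \<Omega> p v \<le> c"
    using approx by blast
  obtain w where w: "w \<in> Lip_loc \<Omega>" "w \<in> L.linhull" "L.gauge (\<lambda>x. w x - v x) < e / 2"
      "energy w \<le> c + ennreal (e / 2)"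
    using BV_modular_approx[OF v(1) c v(3) e2] .
  have "L.gauge (\<lambda>x. w x - u x) < e"
    using L.gauge_diff_triangle[OF w(2) v(1) u] w(3) v(2) by simp
  moreover have "energy w \<le> c + ennreal e"
    using w(4) e2 by (elim order_trans) (auto intro!: add_left_mono ennreal_leI)
  ultimately show "\<exists>w\<in>Lip_loc \<Omega> \<inter> L.linhull. L.gauge (\<lambda>x. w x - u x) < e \<and> energy w \<le> c + ennreal e"
    using w by blast
qed

section \<open>The unit ball of the relaxed modular and the function space that it spans\<close>

definition BVball :: "('a \<Rightarrow> real) set" where
  "BVball = {u \<in> L.linhull. BV_modular \<Omega> p u \<le> 1}"

lemma BVballI:
  assumes "u \<in> L.linhull"
    and "\<And>e. e > 0 \<Longrightarrow> \<exists>w\<in>Lip_loc \<Omega> \<inter> L.linhull. L.gauge (\<lambda>x. w x - u x) < e \<and> energy w \<le> 1 + ennreal e"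
  shows "u \<in> BVball"
  unfolding BVball_def using assms BV_modular_le_iff[of u 1] by simp

lemma BVball_approx:
  assumes "u \<in> BVball" "e > 0"
  obtains w where "w \<in> Lip_loc \<Omega>" "w \<in> L.linhull" "L.gauge (\<lambda>x. w x - u x) < e" "energy w \<le> 1 + ennreal e"
  using assms BV_modular_approx[of u 1 e] unfolding BVball_def by auto

text \<open>Approximants are combined with the same weights as their targets. The bounds
  \<open>e\<close> on the distance and \<open>1 + e\<close> on the energy are both stable under
  convex combinations and sign changes, so no slack is lost.\<close>

sublocale V: unit_ball BVball
proof
  show "(\<lambda>x. 0) \<in> BVball"
  proof (rule BVballI)
    have "(\<lambda>x. 0) \<in> Lip_loc \<Omega>"
      unfolding Lip_loc_def by (auto intro!: exI[of _ 1] lipschitz_onI)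
    moreover have "grad (\<lambda>x::'a. 0) = (\<lambda>x. 0)" by (simp add: grad_def fun_eq_iff)
    then have "energy (\<lambda>x. 0) = 0" by simp
    ultimately show "\<exists>w\<in>Lip_loc \<Omega> \<inter> L.linhull. L.gauge (\<lambda>x. w x - 0) < e \<and> energy w \<le> 1 + ennreal e"
      if "e > 0" for e
      using that by (intro bexI[of _ "\<lambda>x. 0"]) (auto simp: L.gauge_zero L.linhull_zero)
  qed (rule L.linhull_zero)
next
  fix u v :: "'a \<Rightarrow> real" and a b :: real
  assume uv: "u \<in> BVball" "v \<in> BVball" and ab: "0 \<le> a" "0 \<le> b" "a + b = 1"
  then have L: "u \<in> L.linhull" "v \<in> L.linhull" by (auto simp: BVball_def)
  show "(\<lambda>x. a * u x + b * v x) \<in> BVball"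
  proof (rule BVballI)
    fix e :: real assume e: "e > 0"
    obtain w where w: "w \<in> Lip_loc \<Omega>" "w \<in> L.linhull" "L.gauge (\<lambda>x. w x - u x) < e" "energy w \<le> 1 + ennreal e"
      using BVball_approx[OF uv(1) e] .
    obtain z where z: "z \<in> Lip_loc \<Omega>" "z \<in> L.linhull" "L.gauge (\<lambda>x. z x - v x) < e" "energy z \<le> 1 + ennreal e"
      using BVball_approx[OF uv(2) e] .
    note hull = L.linhull_diff[OF w(2) L(1)] L.linhull_diff[OF z(2) L(2)]
    have "L.gauge (\<lambda>x. (a * w x + b * z x) - (a * u x + b * v x)) = L.gauge (\<lambda>x. a * (w x - u x) + b * (z x - v x))"
      by (simp add: algebra_simps)
    also have "\<dots> \<le> a * L.gauge (\<lambda>x. w x - u x) + b * L.gauge (\<lambda>x. z x - v x)"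
      using L.gauge_triangle[OF hull[THEN L.linhull_scale], of a b] ab by (simp add: L.gauge_scale hull)
    also have "\<dots> < e"
      using convex_bound_lt[OF w(3) z(3) ab] .
    finally have 1: "L.gauge (\<lambda>x. (a * w x + b * z x) - (a * u x + b * v x)) < e" .
    have "energy (\<lambda>x. a * w x + b * z x) \<le> ennreal a * energy w + ennreal b * energy z"
      by (rule energy_convex[OF w(1) z(1) ab])
    also have "\<dots> \<le> ennreal a * (1 + ennreal e) + ennreal b * (1 + ennreal e)"
      using w z by (intro add_mono mult_left_mono) auto
    also have "\<dots> = 1 + ennreal e"
      using ab by (simp flip: distrib_right ennreal_plus)
    finally show "\<exists>w\<in>Lip_loc \<Omega> \<inter> L.linhull. L.gauge (\<lambda>x. w x - (a * u x + b * v x)) < e \<and> energy w \<le> 1 + ennreal e"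
      using 1 w z by (intro bexI[of _ "\<lambda>x. a * w x + b * z x"]) (auto intro!: Lip_loc_linear L.linhull_add L.linhull_scale)
  qed (intro L.linhull_add L.linhull_scale L)
next
  fix u assume u: "u \<in> BVball"
  then have L: "u \<in> L.linhull" by (simp add: BVball_def)
  show "(\<lambda>x. - u x) \<in> BVball"
  proof (rule BVballI)
    fix e :: real assume e: "e > 0"
    obtain w where w: "w \<in> Lip_loc \<Omega>" "w \<in> L.linhull" "L.gauge (\<lambda>x. w x - u x) < e" "energy w \<le> 1 + ennreal e"
      using BVball_approx[OF u e] .
    have "(\<lambda>x. - w x) \<in> Lip_loc \<Omega>"
      using Lip_loc_linear[OF w(1) w(1), of "-1" 0] by simp
    moreover have "L.gauge (\<lambda>x. - w x - - u x) < e"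
      using L.gauge_minus_commute[OF w(2) L] w(3) by (simp add: algebra_simps)
    ultimately show "\<exists>w\<in>Lip_loc \<Omega> \<inter> L.linhull. L.gauge (\<lambda>x. w x - - u x) < e \<and> energy w \<le> 1 + ennreal e"
      using w L.linhull_minus[OF w(2)] energy_minus[OF w(1)] by (intro bexI[of _ "\<lambda>x. - w x"]) auto
  qed (rule L.linhull_minus[OF L])
qed

lemma Vhull_subset:
  assumes "u \<in> V.linhull"
  shows "u \<in> L.linhull"
proof -
  obtain l where "l > 0" "(\<lambda>x. u x / l) \<in> L.linhull"
    using assms unfolding V.linhull_def by (auto simp: BVball_def)
  then show ?thesis using L.linhull_scale[of "\<lambda>x. u x / l" l] by simp
qed

text \<open>A finite relaxed modular is brought below 1 by shrinking, through convexity. Conversely,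
  undoing the scaling stretches by some \<open>l \<ge> 1\<close> and multiplies the energy by at
  most \<open>l powr P\<close>, by boundedness of the exponent.\<close>

lemma BV_fun_eq: "BV_fun \<Omega> p = V.linhull"
proof (intro subset_antisym subsetI)
  fix u assume "u \<in> BV_fun \<Omega> p"
  then have u: "u \<in> L.linhull" and fin: "BV_modular \<Omega> p u < \<infinity>"
    by (auto simp: BV_fun_def Lp_var_eq)
  obtain c where c: "BV_modular \<Omega> p u = ennreal c" "c \<ge> 0"
    using fin by (cases "BV_modular \<Omega> p u") auto
  \<comment> \<open>A divisor of at least 1 suits \<open>energy_shrink\<close>; as it is also at
    least \<open>c\<close>, the energy bound \<open>c + e\<close> drops to at most
    \<open>1 + e\<close>.\<close>
  define m where "m = max c 1"
  have m: "c \<le> m" "1 \<le> m" by (auto simp: m_def)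
  have "(\<lambda>x. u x / m) \<in> BVball"
  proof (rule BVballI)
    show um: "(\<lambda>x. u x / m) \<in> L.linhull" using L.linhull_scale[OF u, of "1 / m"] by simp
    fix e :: real assume e: "e > 0"
    obtain w where w: "w \<in> Lip_loc \<Omega>" "w \<in> L.linhull" "L.gauge (\<lambda>x. w x - u x) < e" "energy w \<le> ennreal c + ennreal e"
      using BV_modular_approx[OF u _ _ e, of "ennreal c"] c by auto
    have lip: "(\<lambda>x. 1 / m * w x) \<in> Lip_loc \<Omega>"
      using Lip_loc_linear[OF w(1) w(1), of "1 / m" 0] by simp
    have "L.gauge (\<lambda>x. 1 / m * (w x - u x)) = \<bar>1 / m\<bar> * L.gauge (\<lambda>x. w x - u x)"
      by (intro L.gauge_scale L.linhull_diff w u)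
    also have "\<dots> \<le> 1 * L.gauge (\<lambda>x. w x - u x)"
      using m L.gauge_nonneg[OF L.linhull_diff[OF w(2) u]] by (intro mult_right_mono) auto
    finally have 1: "L.gauge (\<lambda>x. 1 / m * w x - u x / m) < e"
      using w(3) by (simp add: diff_divide_distrib)
    have "energy (\<lambda>x. 1 / m * w x) \<le> ennreal (1 / m) * energy w"
      using m by (intro energy_shrink w) auto
    also have "\<dots> \<le> ennreal (1 / m) * ennreal (c + e)"
      using w(4) c e by (intro mult_left_mono) auto
    also have "\<dots> = ennreal (1 / m * (c + e))"
      using m c e by (subst ennreal_mult) auto
    also have "\<dots> \<le> ennreal (1 + e)"
    proof (rule ennreal_leI)
      have "e * 1 \<le> e * m" using m e by (intro mult_left_mono) auto
      then show "1 / m * (c + e) \<le> 1 + e" using m by (simp add: field_simps)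
    qed
    also have "\<dots> = 1 + ennreal e" using e by simp
    finally show "\<exists>w\<in>Lip_loc \<Omega> \<inter> L.linhull. L.gauge (\<lambda>x. w x - u x / m) < e \<and> energy w \<le> 1 + ennreal e"
      using 1 lip L.linhull_scale[OF w(2), of "1 / m"] by (intro bexI[of _ "\<lambda>x. 1 / m * w x"]) auto
  qed
  then show "u \<in> V.linhull" unfolding V.linhull_def using m by (intro CollectI exI[of _ m]) auto
next
  fix u assume u: "u \<in> V.linhull"
  note uL = Vhull_subset[OF u]
  obtain l0 where l0: "l0 > 0" "(\<lambda>x. u x / l0) \<in> BVball" using u by (auto simp: V.linhull_def)
  \<comment> \<open>Enlarging the scale keeps \<open>u / l\<close> in the ball and makes
    \<open>l\<close> an admissible factor in \<open>energy_stretch\<close>.\<close>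
  define l where "l = max l0 1"
  have l: "1 \<le> l" "l0 \<le> l" by (auto simp: l_def)
  have mem: "(\<lambda>x. u x / l) \<in> BVball" using V.divide_mem_mono[OF l0(2,1) l(2)] .
  then have ul: "(\<lambda>x. u x / l) \<in> L.linhull" by (simp add: BVball_def)
  have "BV_modular \<Omega> p u \<le> ennreal (l powr P * 2)"
  proof (subst BV_modular_le_iff[OF uL], simp, intro allI impI)
    fix e :: real assume "e > 0"
    \<comment> \<open>The bound 1 limits the stretched energy to \<open>l powr P * 2\<close>; the
      bound \<open>e / l\<close> becomes a distance below \<open>e\<close> after multiplication by
      \<open>l\<close>.\<close>
    define d where "d = min 1 (e / l)"
    have d: "d > 0" "d \<le> 1" "d \<le> e / l" using \<open>e > 0\<close> l by (auto simp: d_def)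
    obtain w where w: "w \<in> Lip_loc \<Omega>" "w \<in> L.linhull" "L.gauge (\<lambda>x. w x - u x / l) < d" "energy w \<le> 1 + ennreal d"
      using BVball_approx[OF mem d(1)] .
    have lip: "(\<lambda>x. l * w x) \<in> Lip_loc \<Omega>"
      using Lip_loc_linear[OF w(1) w(1), of l 0] by simp
    have "L.gauge (\<lambda>x. l * (w x - u x / l)) = \<bar>l\<bar> * L.gauge (\<lambda>x. w x - u x / l)"
      by (intro L.gauge_scale L.linhull_diff w ul)
    also have "\<bar>l\<bar> = l" using l by simp
    also have "l * L.gauge (\<lambda>x. w x - u x / l) < l * (e / l)"
      using l less_le_trans[OF w(3) d(3)] by (intro mult_strict_left_mono) simp_all
    finally have 1: "L.gauge (\<lambda>x. l * w x - u x) < e"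
      using l by (simp add: right_diff_distrib)
    have "energy (\<lambda>x. l * w x) \<le> ennreal (l powr P) * energy w"
      using l by (intro energy_stretch w) auto
    also have "\<dots> \<le> ennreal (l powr P) * ennreal (1 + d)"
      using w(4) d by (intro mult_left_mono) auto
    also have "\<dots> \<le> ennreal (l powr P * 2)"
      using d by (subst ennreal_mult[symmetric]) (auto intro!: ennreal_leI mult_left_mono)
    also have "\<dots> \<le> ennreal (l powr P * 2) + ennreal e" by simp
    finally show "\<exists>w\<in>Lip_loc \<Omega> \<inter> L.linhull. L.gauge (\<lambda>x. w x - u x) < e \<and> energy w \<le> ennreal (l powr P * 2) + ennreal e"
      using 1 lip L.linhull_scale[OF w(2), of l] by (intro bexI[of _ "\<lambda>x. l * w x"]) auto
  qed
  then show "u \<in> BV_fun \<Omega> p"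
    using uL by (auto simp: BV_fun_def Lp_var_eq intro: le_less_trans)
qed

lemma BV_fun_norm_eq:
  assumes "u \<in> V.linhull"
  shows "BV_fun_norm \<Omega> p u = L.gauge u + V.gauge u"
proof -
  note u = Vhull_subset[OF assms]
  have "(\<lambda>x. u x / l) \<in> L.linhull" for l using L.linhull_scale[OF u, of "1 / l"] by simp
  then show ?thesis
    unfolding BV_fun_norm_def V.gauge_def by (simp add: Lp_norm_eq u BVball_def)
qed

lemma BV_fun_complete:
  assumes s: "\<And>i. s i \<in> V.linhull"
    and Cauchy: "\<And>e. e > 0 \<Longrightarrow> \<exists>N. \<forall>i\<ge>N. \<forall>j\<ge>N. L.gauge (\<lambda>x. s i x - s j x) + V.gauge (\<lambda>x. s i x - s j x) < e"
  shows "\<exists>u\<in>V.linhull. (\<lambda>i. L.gauge (\<lambda>x. s i x - u x) + V.gauge (\<lambda>x. s i x - u x)) \<longlonglongrightarrow> 0"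
proof -
  note sL = Vhull_subset[OF s]
  have nonneg: "0 \<le> L.gauge (\<lambda>x. s i x - s j x)" "0 \<le> V.gauge (\<lambda>x. s i x - s j x)" for i j
    by (intro L.gauge_nonneg L.linhull_diff sL V.gauge_nonneg V.linhull_diff s)+
  have "\<exists>N. \<forall>i\<ge>N. \<forall>j\<ge>N. L.gauge (\<lambda>x. s i x - s j x) < e" if "e > 0" for e
    using Cauchy[OF that] nonneg by (smt (verit))
  with sL obtain u where u: "u \<in> L.linhull" and lim: "(\<lambda>i. L.gauge (\<lambda>x. s i x - u x)) \<longlonglongrightarrow> 0"
    using Lhull_complete by blast
  have main: "\<exists>N. \<forall>i\<ge>N. (\<lambda>x. (s i x - u x) / e) \<in> BVball" if e: "e > 0" for e
  proof -
    obtain N where N: "\<And>i j. \<lbrakk>i \<ge> N; j \<ge> N\<rbrakk> \<Longrightarrow> L.gauge (\<lambda>x. s i x - s j x) + V.gauge (\<lambda>x. s i x - s j x) < e"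
      using Cauchy[OF e] by blast
    show ?thesis
    proof (intro exI[of _ N] allI impI)
      fix i assume i: "N \<le> i"
      have hull: "(\<lambda>x. (s i x - v x) / e) \<in> L.linhull" if "v \<in> L.linhull" for v
        using L.linhull_scale[OF L.linhull_diff[OF sL[of i] that], of "1 / e"] by simp
      have "BV_modular \<Omega> p (\<lambda>x. (s i x - u x) / e) \<le> 1"
      proof (rule BV_modular_lsc[OF hull[OF u]])
        fix d :: real assume "d > 0"
        \<comment> \<open>Dividing by \<open>e\<close> turns a distance of \<open>e * d\<close>
          between \<open>s j\<close> and \<open>u\<close> into a distance of \<open>d\<close>
          between the scaled differences.\<close>
        with e have "e * d > 0" by simp
        with lim have "\<forall>\<^sub>F j in sequentially. L.gauge (\<lambda>x. s j x - u x) < e * d"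
          by (rule order_tendstoD)
        then obtain K where "\<And>j. j \<ge> K \<Longrightarrow> L.gauge (\<lambda>x. s j x - u x) < e * d"
          by (auto simp: eventually_sequentially)
        then obtain j where j: "j \<ge> N" "L.gauge (\<lambda>x. s j x - u x) < e * d"
          using max.cobounded1 max.cobounded2 by blast
        have "(\<lambda>x. (s i x - s j x) / e) \<in> BVball"
          using N[OF i j(1)] nonneg(1)[of i j] by (intro V.gauge_less_imp_mem V.linhull_diff s) linarith
        moreover have "L.gauge (\<lambda>x. (s i x - s j x) / e - (s i x - u x) / e) < d"
        proof -
          have "L.gauge (\<lambda>x. (s i x - s j x) / e - (s i x - u x) / e) = L.gauge (\<lambda>x. (- 1 / e) * (s j x - u x))"
            using e by (intro arg_cong[of _ _ L.gauge] ext) (simp add: field_simps)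
          also have "\<dots> = 1 / e * L.gauge (\<lambda>x. s j x - u x)"
            using e by (subst L.gauge_scale[OF L.linhull_diff[OF sL u]]) simp
          also have "\<dots> < d" using j e by (simp add: field_simps)
          finally show ?thesis .
        qed
        ultimately show "\<exists>v\<in>L.linhull. L.gauge (\<lambda>x. v x - (s i x - u x) / e) < d \<and> BV_modular \<Omega> p v \<le> 1"
          using hull[OF sL[of j]] by (intro bexI[of _ "\<lambda>x. (s i x - s j x) / e"]) (auto simp: BVball_def)
      qed simp
      then show "(\<lambda>x. (s i x - u x) / e) \<in> BVball"
        using hull[OF u] by (simp add: BVball_def)
    qed
  qed
  have "u \<in> V.linhull"
  proof -
    obtain N where "(\<lambda>x. (s N x - u x) / 1) \<in> BVball" using main[of 1] by auto
    then have "(\<lambda>x. s N x - u x) \<in> V.linhull" unfolding V.linhull_def by (intro CollectI exI[of _ 1]) simp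
    from V.linhull_diff[OF s[of N] this] show ?thesis by simp
  qed
  moreover have "(\<lambda>i. V.gauge (\<lambda>x. s i x - u x)) \<longlonglongrightarrow> 0"
  proof (rule LIMSEQ_I)
    fix e :: real assume "e > 0"
    then obtain N where N: "\<And>i. i \<ge> N \<Longrightarrow> (\<lambda>x. (s i x - u x) / (e / 2)) \<in> BVball"
      using main[of "e / 2"] by auto
    have "norm (V.gauge (\<lambda>x. s i x - u x) - 0) < e" if "i \<ge> N" for i
      using V.gauge_le[OF _ N[OF that]] V.gauge_nonneg[OF V.linhull_diff[OF s \<open>u \<in> V.linhull\<close>], of i] \<open>e > 0\<close> by auto
    then show "\<exists>N. \<forall>i\<ge>N. norm (V.gauge (\<lambda>x. s i x - u x) - 0) < e" by blast
  qed
  ultimately show ?thesis using tendsto_add[OF lim] by (intro bexI[of _ u]) auto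
qed

end

subsection \<open>The space of equivalence classes\<close>

lemma modular_cong_AE:
  assumes "AE x in lebesgue_on \<Omega>. u x = v x"
  shows "modular \<Omega> p u = modular \<Omega> p v"
  unfolding modular_def using assms by (intro nn_integral_cong_AE) auto

lemma Lp_norm_cong_AE:
  assumes "AE x in lebesgue_on \<Omega>. u x = v x"
  shows "Lp_norm \<Omega> p u = Lp_norm \<Omega> p v"
proof -
  have "modular \<Omega> p (\<lambda>x. u x / l) = modular \<Omega> p (\<lambda>x. v x / l)" for l
    using assms by (intro modular_cong_AE) auto
  then show ?thesis by (simp add: Lp_norm_def)
qed

lemma BV_modular_cong_AE:
  assumes "AE x in lebesgue_on \<Omega>. u x = v x"
  shows "BV_modular \<Omega> p u = BV_modular \<Omega> p v"
proof -
  have "Lp_norm \<Omega> p (\<lambda>x. w x - u x) = Lp_norm \<Omega> p (\<lambda>x. w x - v x)" for w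
    using assms by (intro Lp_norm_cong_AE) auto
  then show ?thesis by (simp add: BV_modular_def)
qed

lemma BV_fun_norm_cong_AE:
  assumes "AE x in lebesgue_on \<Omega>. u x = v x"
  shows "BV_fun_norm \<Omega> p u = BV_fun_norm \<Omega> p v"
proof -
  have "BV_modular \<Omega> p (\<lambda>x. u x / l) = BV_modular \<Omega> p (\<lambda>x. v x / l)" for l
    using assms by (intro BV_modular_cong_AE) auto
  then show ?thesis using Lp_norm_cong_AE[OF assms] by (simp add: BV_fun_norm_def)
qed

text \<open>The relation lives on all measurable functions and not only on \<open>BV_fun\<close>, so
  the class of a member contains each of its measurable modifications on null sets.\<close>

lemma equiv_ae_rel: "equiv (borel_measurable (lebesgue_on \<Omega>)) (ae_rel \<Omega>)"
proof (rule equivI)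
  show "ae_rel \<Omega> \<subseteq> borel_measurable (lebesgue_on \<Omega>) \<times> borel_measurable (lebesgue_on \<Omega>)"
    by (auto simp: ae_rel_def)
  show "refl_on (borel_measurable (lebesgue_on \<Omega>)) (ae_rel \<Omega>)"
    by (auto simp: refl_on_def ae_rel_def)
  show "sym (ae_rel \<Omega>)"
    by (auto simp: sym_def ae_rel_def elim: eventually_mono)
  show "trans (ae_rel \<Omega>)"
    unfolding trans_def ae_rel_def by (auto elim: eventually_elim2)
qed

lemma ae_class_eq_iff:
  assumes "u \<in> borel_measurable (lebesgue_on \<Omega>)" "v \<in> borel_measurable (lebesgue_on \<Omega>)"
  shows "ae_rel \<Omega> `` {u} = ae_rel \<Omega> `` {v} \<longleftrightarrow> (AE x in lebesgue_on \<Omega>. u x = v x)"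
  using eq_equiv_class_iff[OF equiv_ae_rel assms] assms by (simp add: ae_rel_def)

text \<open>Addition is defined as a union over all pairs of representatives; by congruence every
  term of the union is the same class, so the union collapses.\<close>

lemma BV_space_add_class:
  assumes "u \<in> borel_measurable (lebesgue_on \<Omega>)" "v \<in> borel_measurable (lebesgue_on \<Omega>)"
  shows "ae_rel \<Omega> `` {u} \<oplus>\<^bsub>BV_space \<Omega> p\<^esub> ae_rel \<Omega> `` {v} = ae_rel \<Omega> `` {\<lambda>x. u x + v x}"
proof -
  have "congruent2 (ae_rel \<Omega>) (ae_rel \<Omega>) (\<lambda>u v. ae_rel \<Omega> `` {\<lambda>x. u x + v x})"
  proof (intro congruent2I')
    fix u u' v v' assume "(u, u') \<in> ae_rel \<Omega>" "(v, v') \<in> ae_rel \<Omega>"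
    then have "u \<in> borel_measurable (lebesgue_on \<Omega>)" "u' \<in> borel_measurable (lebesgue_on \<Omega>)"
      "v \<in> borel_measurable (lebesgue_on \<Omega>)" "v' \<in> borel_measurable (lebesgue_on \<Omega>)"
      and ae: "AE x in lebesgue_on \<Omega>. u x = u' x" "AE x in lebesgue_on \<Omega>. v x = v' x"
      by (auto simp: ae_rel_def)
    moreover have "AE x in lebesgue_on \<Omega>. u x + v x = u' x + v' x"
      using ae by eventually_elim simp
    ultimately show "ae_rel \<Omega> `` {\<lambda>x. u x + v x} = ae_rel \<Omega> `` {\<lambda>x. u' x + v' x}"
      by (simp add: ae_class_eq_iff)
  qed
  from UN_equiv_class2[OF equiv_ae_rel equiv_ae_rel this assms] show ?thesis
    by (simp add: BV_space_def)
qed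

lemma BV_space_smult_class:
  assumes "u \<in> borel_measurable (lebesgue_on \<Omega>)"
  shows "a \<odot>\<^bsub>BV_space \<Omega> p\<^esub> ae_rel \<Omega> `` {u} = ae_rel \<Omega> `` {\<lambda>x. a * u x}"
proof -
  have "congruent (ae_rel \<Omega>) (\<lambda>u. ae_rel \<Omega> `` {\<lambda>x. a * u x})"
  proof (rule congruentI)
    fix u u' assume "(u, u') \<in> ae_rel \<Omega>"
    then have "u \<in> borel_measurable (lebesgue_on \<Omega>)" "u' \<in> borel_measurable (lebesgue_on \<Omega>)"
      and ae: "AE x in lebesgue_on \<Omega>. u x = u' x"
      by (auto simp: ae_rel_def)
    moreover have "AE x in lebesgue_on \<Omega>. a * u x = a * u' x"
      using ae by eventually_elim simp
    ultimately show "ae_rel \<Omega> `` {\<lambda>x. a * u x} = ae_rel \<Omega> `` {\<lambda>x. a * u' x}"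
      by (simp add: ae_class_eq_iff)
  qed
  from UN_equiv_class[OF equiv_ae_rel this assms] show ?thesis
    by (simp add: BV_space_def)
qed

text \<open>All representatives have the same norm, so the image under \<open>BV_fun_norm\<close> is
  a singleton and \<open>the_elem\<close> returns its element.\<close>

lemma BV_norm_class:
  assumes "u \<in> borel_measurable (lebesgue_on \<Omega>)"
  shows "BV_norm \<Omega> p (ae_rel \<Omega> `` {u}) = BV_fun_norm \<Omega> p u"
proof -
  have "u \<in> ae_rel \<Omega> `` {u}" using equiv_class_self[OF equiv_ae_rel assms] .
  moreover have "BV_fun_norm \<Omega> p v = BV_fun_norm \<Omega> p u" if "v \<in> ae_rel \<Omega> `` {u}" for v
    using that by (intro BV_fun_norm_cong_AE) (auto simp: ae_rel_def elim: eventually_mono)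
  ultimately have "BV_fun_norm \<Omega> p ` (ae_rel \<Omega> `` {u}) = {BV_fun_norm \<Omega> p u}" by blast
  then show ?thesis by (simp add: BV_norm_def)
qed

section \<open>Module axioms, norm axioms and completeness on classes\<close>

context bounded_variable_exponent
begin

abbreviation cls :: "('a \<Rightarrow> real) \<Rightarrow> ('a \<Rightarrow> real) set" where
  "cls u \<equiv> ae_rel \<Omega> `` {u}"

lemma Vhull_measurable: "u \<in> V.linhull \<Longrightarrow> u \<in> borel_measurable (lebesgue_on \<Omega>)"
  by (intro Lhull_measurable Vhull_subset)

lemma carrier_BV_space: "carrier (BV_space \<Omega> p) = cls ` V.linhull"
  by (auto simp: BV_space_def BV_fun_eq quotient_def)

lemma zero_BV_space: "\<zero>\<^bsub>BV_space \<Omega> p\<^esub> = cls (\<lambda>x. 0)"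
  by (simp add: BV_space_def)

lemma add_cls: "\<lbrakk>u \<in> V.linhull; v \<in> V.linhull\<rbrakk> \<Longrightarrow> cls u \<oplus>\<^bsub>BV_space \<Omega> p\<^esub> cls v = cls (\<lambda>x. u x + v x)"
  by (intro BV_space_add_class Vhull_measurable)

lemma smult_cls: "u \<in> V.linhull \<Longrightarrow> a \<odot>\<^bsub>BV_space \<Omega> p\<^esub> cls u = cls (\<lambda>x. a * u x)"
  by (intro BV_space_smult_class Vhull_measurable)

lemma BV_norm_cls: "u \<in> V.linhull \<Longrightarrow> BV_norm \<Omega> p (cls u) = L.gauge u + V.gauge u"
  by (simp add: BV_norm_class Vhull_measurable BV_fun_norm_eq)

lemma module_BV_space: "module (ring_of_type_algebra :: real ring) (BV_space \<Omega> p)"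
proof (rule moduleI)
  show "cring (ring_of_type_algebra :: real ring)" by (rule cring_from_type_algebra)
next
  show "abelian_group (BV_space \<Omega> p)"
  \<comment> \<open>Each element of the carrier is replaced by the class of a function in
    \<open>V.linhull\<close>, so that the group axioms become pointwise identities.\<close>
  proof (rule abelian_groupI; (unfold carrier_BV_space zero_BV_space)?; (elim imageE)?; hypsubst?)
    show "cls u \<oplus>\<^bsub>BV_space \<Omega> p\<^esub> cls v \<in> cls ` V.linhull" if "u \<in> V.linhull" "v \<in> V.linhull" for u v
      using that by (simp add: add_cls V.linhull_add)
    show "cls (\<lambda>x. 0) \<in> cls ` V.linhull" by (intro imageI V.linhull_zero)
    show "cls u \<oplus>\<^bsub>BV_space \<Omega> p\<^esub> cls v \<oplus>\<^bsub>BV_space \<Omega> p\<^esub> cls w = cls u \<oplus>\<^bsub>BV_space \<Omega> p\<^esub> (cls v \<oplus>\<^bsub>BV_space \<Omega> p\<^esub> cls w)"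
      if "u \<in> V.linhull" "v \<in> V.linhull" "w \<in> V.linhull" for u v w
      using that by (simp add: add_cls V.linhull_add add.assoc)
    show "cls u \<oplus>\<^bsub>BV_space \<Omega> p\<^esub> cls v = cls v \<oplus>\<^bsub>BV_space \<Omega> p\<^esub> cls u" if "u \<in> V.linhull" "v \<in> V.linhull" for u v
      using that by (simp add: add_cls add.commute)
    show "cls (\<lambda>x. 0) \<oplus>\<^bsub>BV_space \<Omega> p\<^esub> cls u = cls u" if "u \<in> V.linhull" for u
      using that by (simp add: add_cls V.linhull_zero)
    show "\<exists>y\<in>cls ` V.linhull. y \<oplus>\<^bsub>BV_space \<Omega> p\<^esub> cls u = cls (\<lambda>x. 0)" if "u \<in> V.linhull" for u
      using that by (intro bexI[of _ "cls (\<lambda>x. - u x)"]) (simp_all add: add_cls V.linhull_minus)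
  qed
qed (auto simp: carrier_BV_space add_cls smult_cls V.linhull_add V.linhull_scale ring_of_type_algebra_def algebra_simps)

text \<open>Subtraction goes through the abstract additive inverse, which is first identified by its
  uniqueness.\<close>

lemma minus_cls:
  assumes "u \<in> V.linhull" "v \<in> V.linhull"
  shows "cls u \<ominus>\<^bsub>BV_space \<Omega> p\<^esub> cls v = cls (\<lambda>x. u x - v x)"
proof -
  interpret module "ring_of_type_algebra :: real ring" "BV_space \<Omega> p" by (rule module_BV_space)
  have "\<ominus>\<^bsub>BV_space \<Omega> p\<^esub> cls v = cls (\<lambda>x. - v x)"
    using assms by (intro M.minus_equality) (auto simp: carrier_BV_space add_cls V.linhull_minus zero_BV_space)
  then show ?thesis using assms by (simp add: a_minus_def add_cls V.linhull_minus)
qed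

lemma banach_space_BV_space: "banach_space (BV_space \<Omega> p) (BV_norm \<Omega> p)"
proof (intro banach_space.intro module_BV_space banach_space_axioms.intro)
  let ?V = "BV_space \<Omega> p"
  have nonneg: "0 \<le> L.gauge u" "0 \<le> V.gauge u" if "u \<in> V.linhull" for u
    using that by (auto intro: L.gauge_nonneg V.gauge_nonneg Vhull_subset)
  show "0 \<le> BV_norm \<Omega> p x" if "x \<in> carrier ?V" for x
    using that nonneg by (auto simp: carrier_BV_space BV_norm_cls)
  show "BV_norm \<Omega> p x = 0 \<longleftrightarrow> x = \<zero>\<^bsub>?V\<^esub>" if x: "x \<in> carrier ?V" for x
  proof -
    obtain u where u: "x = cls u" "u \<in> V.linhull" using x by (auto simp: carrier_BV_space)
    show ?thesis
    proof
      assume "BV_norm \<Omega> p x = 0"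
      \<comment> \<open>Definiteness comes from the Lebesgue part: \<open>V.gauge\<close> is only a
        seminorm and vanishes on constants whenever \<open>\<Omega>\<close> has finite
        measure.\<close>
      then have "L.gauge u = 0" using u nonneg[OF u(2)] by (simp add: BV_norm_cls)
      then show "x = \<zero>\<^bsub>?V\<^esub>"
        using u by (simp add: zero_BV_space ae_class_eq_iff Vhull_measurable Vhull_subset Lgauge_eq_0_iff)
    next
      assume "x = \<zero>\<^bsub>?V\<^esub>"
      then have "BV_norm \<Omega> p x = L.gauge (\<lambda>x. 0) + V.gauge (\<lambda>x. 0)"
        by (simp add: zero_BV_space BV_norm_cls V.linhull_zero)
      then show "BV_norm \<Omega> p x = 0" by (simp add: L.gauge_zero V.gauge_zero)
    qed
  qed
  show "BV_norm \<Omega> p (a \<odot>\<^bsub>?V\<^esub> x) = \<bar>a\<bar> * BV_norm \<Omega> p x" if "x \<in> carrier ?V" for a x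
    using that by (auto simp: carrier_BV_space smult_cls BV_norm_cls V.linhull_scale L.gauge_scale V.gauge_scale
        Vhull_subset distrib_left)
  show "BV_norm \<Omega> p (x \<oplus>\<^bsub>?V\<^esub> y) \<le> BV_norm \<Omega> p x + BV_norm \<Omega> p y" if xy: "x \<in> carrier ?V" "y \<in> carrier ?V" for x y
  proof -
    obtain u v where u: "x = cls u" "u \<in> V.linhull" and v: "y = cls v" "v \<in> V.linhull"
      using xy by (auto simp: carrier_BV_space)
    then show ?thesis
      using L.gauge_triangle[OF Vhull_subset[OF u(2)] Vhull_subset[OF v(2)]] V.gauge_triangle[OF u(2) v(2)]
      by (simp add: add_cls BV_norm_cls V.linhull_add)
  qed
  show "\<exists>x\<in>carrier ?V. (\<lambda>i. BV_norm \<Omega> p (s i \<ominus>\<^bsub>?V\<^esub> x)) \<longlonglongrightarrow> 0"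
    if s: "\<And>i. s i \<in> carrier ?V"
      and Cauchy: "\<And>e. e > 0 \<Longrightarrow> \<exists>N. \<forall>i\<ge>N. \<forall>j\<ge>N. BV_norm \<Omega> p (s i \<ominus>\<^bsub>?V\<^esub> s j) < e" for s :: "nat \<Rightarrow> _"
  proof -
    have "\<forall>i. \<exists>u. s i = cls u \<and> u \<in> V.linhull" using s by (auto simp: carrier_BV_space)
    then obtain f where f: "\<And>i. s i = cls (f i)" "\<And>i. f i \<in> V.linhull" by metis
    have norm: "BV_norm \<Omega> p (s i \<ominus>\<^bsub>?V\<^esub> cls v) = L.gauge (\<lambda>x. f i x - v x) + V.gauge (\<lambda>x. f i x - v x)"
      if "v \<in> V.linhull" for i v
      using that f by (simp add: minus_cls BV_norm_cls V.linhull_diff)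
    have norm': "BV_norm \<Omega> p (s i \<ominus>\<^bsub>?V\<^esub> s j) = L.gauge (\<lambda>x. f i x - f j x) + V.gauge (\<lambda>x. f i x - f j x)" for i j
      using norm[OF f(2)[of j], of i] f(1)[of j] by simp
    obtain u where u: "u \<in> V.linhull"
      "(\<lambda>i. L.gauge (\<lambda>x. f i x - u x) + V.gauge (\<lambda>x. f i x - u x)) \<longlonglongrightarrow> 0"
      using BV_fun_complete[OF f(2) Cauchy[unfolded norm']] by blast
    then show ?thesis
      by (intro bexI[of _ "cls u"]) (auto simp: norm carrier_BV_space)
  qed
qed

end

theorem theorem4p5:
  fixes \<Omega> :: "'a::euclidean_space set" and p :: "'a \<Rightarrow> real"
  assumes "open \<Omega>"
    and "p \<in> borel_measurable (lebesgue_on \<Omega>)"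
    and "\<And>x. x \<in> \<Omega> \<Longrightarrow> 1 \<le> p x"
    and "esssup (lebesgue_on \<Omega>) (\<lambda>x. ereal (p x)) < \<infinity>"
  shows "banach_space (BV_space \<Omega> p) (BV_norm \<Omega> p)"
proof -
  \<comment> \<open>The essential supremum is minus infinity for empty \<open>\<Omega>\<close>, so a
    real number above it is chosen instead of its real value.\<close>
  obtain P where P: "esssup (lebesgue_on \<Omega>) (\<lambda>x. ereal (p x)) < ereal P"
    using assms(4) ereal_dense2 by blast
  have "AE x in lebesgue_on \<Omega>. ereal (p x) \<le> esssup (lebesgue_on \<Omega>) (\<lambda>x. ereal (p x))"
    by (rule esssup_AE)
  then have "AE x in lebesgue_on \<Omega>. p x \<le> P"
  proof eventually_elim
    case (elim x)
    then have "ereal (p x) < ereal P" using P by (rule le_less_trans)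
    then show ?case by simp
  qed
  then interpret bounded_variable_exponent \<Omega> p P
    by unfold_locales (use assms in auto)
  show ?thesis by (rule banach_space_BV_space)
qed

end
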